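(* Let $n\ge 2$ be an integer, let $a_0,a_1,\dots,a_n$ be nonnegative integers, and let $Q_1$ be a subset of $\{(i,j)\mid 2\le i<j\le n\}$. Let $T=E\overline{Q_1}$ be the tournament on $\{1,\dots,n\}$ in which, for $1\le i<j\le n$, $i\to j$ if $(i,j)\notin Q_1$ and $j\to i$ if $(i,j)\in Q_1$. Then $$\mathop{\mathrm{CT}}_{\mathbf{x}}\ \frac{x_0}{x_1}\prod_{(i,j)\in Q_1}\frac{x_j}{x_i}\ D_n(\mathbf{x},\mathbf{a},q)=0$$ if $T$ is nontransitive, and if $T$ is transitive with winner permutation $\sigma$, then $$\mathop{\mathrm{CT}}_{\mathbf{x}}\ \frac{x_0}{x_1}\prod_{(i,j)\in Q_1}\frac{x_j}{x_i}\ D_n(\mathbf{x},\mathbf{a},q)=(-1)^{|Q_1|}\,\frac{q^{a_{\sigma(1)}}-q^{a_{\sigma(2)}}}{1-q^{a_0+a_{\sigma(2)}}}\cdot\frac{(q)_{a_0+a_1+\cdots+a_n}}{(q)_{a_0}(q)_{a_1}\cdots(q)_{a_n}}\prod_{i=1}^{n}\frac{1-q^{a_i}}{1-q^{a_0+\sigma_i}},$$ where $\sigma_i=\sum_{k=1}^{i}a_{\sigma(k)}$.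
   Context: $q$ is an indeterminate, $K=\mathbb{C}(q)$, $\mathbf{x}=(x_0,\dots,x_n)$, $\mathbf{a}=(a_0,\dots,a_n)$. For an integer $k$, $(z)_k=(z;q)_\infty/(zq^k;q)_\infty$, i.e. $(z)_k=(1-z)(1-zq)\cdots(1-zq^{k-1})$ for $k\ge0$ and $(z)_k=1/\big((1-zq^k)(1-zq^{k+1})\cdots(1-zq^{-1})\big)$ for $k<0$. The $q$-Dyson style product is $D_n(\mathbf{x},\mathbf{a},q)=\prod_{0\le i<j\le n}\left(\frac{x_i}{x_j}\right)_{a_i}\left(\frac{x_j}{x_i}q\right)_{a_j-1}$. All rational functions are expanded in the field of iterated Laurent series $K((x_n))((x_{n-1}))\cdots((x_0))$ (so that, e.g., $1/(1-cx_i/x_j)=\sum_{l\ge0}c^lx_i^lx_j^{-l}$ when $i<j$), and $\mathop{\mathrm{CT}}_{\mathbf{x}}$ denotes the constant term in all of $x_0,\dots,x_n$. $|Q_1|$ is the number of elements of $Q_1$. A tournament is transitive if it contains no directed 3-cycle $i\to j\to k\to i$. For a transitive tournament $T$ on $\{1,\dots,n\}$, the winner permutation is the permutation $\sigma$ of $\{1,\dots,n\}$ with $\sigma(1)\to\sigma(2)\to\cdots\to\sigma(n)$ in $T$. *)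

theory Defs
  imports "HOL-Computational_Algebra.Computational_Algebra" "HOL-Combinatorics.Permutations"
begin

type_synonym K = "complex poly fract"

definition qq :: K where "qq = Fract [:0, 1:] 1"

text \<open>Iterated Laurent series in x_0,...,x_n over K, represented by their coefficient
  functions: an exponent vector is a function nat => int (only indices 0..n are used).
  Multiplication is the Cauchy product; for elements of the field of iterated Laurent
  series K((x_n))...((x_0)) the sum defining each coefficient is finite.\<close>
type_synonym ser = "(nat \<Rightarrow> int) \<Rightarrow> K"

definition ser_mult :: "ser \<Rightarrow> ser \<Rightarrow> ser" where
  "ser_mult f g = (\<lambda>\<gamma>. \<Sum>\<alpha>\<in>{\<alpha>. f \<alpha> \<noteq> 0 \<and> g (\<lambda>k. \<gamma> k - \<alpha> k) \<noteq> 0}.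
                         f \<alpha> * g (\<lambda>k. \<gamma> k - \<alpha> k))"

definition ser_one :: ser where
  "ser_one = (\<lambda>\<beta>. if \<beta> = (\<lambda>_. 0) then 1 else 0)"

definition ser_monom :: "(nat \<Rightarrow> int) \<Rightarrow> ser" where
  "ser_monom e = (\<lambda>\<beta>. if \<beta> = e then 1 else 0)"

definition ser_prod_list :: "ser list \<Rightarrow> ser" where
  "ser_prod_list xs = foldr ser_mult xs ser_one"

definition ct :: "ser \<Rightarrow> K" where
  "ct f = f (\<lambda>_. 0)"

definition evec :: "nat \<Rightarrow> nat \<Rightarrow> nat \<Rightarrow> int" where
  "evec i j = (\<lambda>k. (if k = i then 1 else 0) - (if k = j then 1 else 0))"

definition one_minus :: "K \<Rightarrow> nat \<Rightarrow> nat \<Rightarrow> ser" where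
  "one_minus c i j = (\<lambda>\<beta>. (if \<beta> = (\<lambda>_. 0) then 1 else 0) - (if \<beta> = evec i j then c else 0))"

text \<open>The expansion of 1/(1 - c x_i/x_j) (i ~= j, c ~= 0) in K((x_n))...((x_0)):
  for i < j it is sum_{l>=0} c^l (x_i/x_j)^l; for i > j it is
  -sum_{l>=1} c^(-l) (x_j/x_i)^l.\<close>
definition inv_one_minus :: "K \<Rightarrow> nat \<Rightarrow> nat \<Rightarrow> ser" where
  "inv_one_minus c i j = (\<lambda>\<beta>.
     if i < j then (\<Sum>l\<in>{l::nat. \<beta> = (\<lambda>k. int l * evec i j k)}. c ^ l)
     else (\<Sum>l\<in>{l::nat. 1 \<le> l \<and> \<beta> = (\<lambda>k. int l * evec j i k)}. - (inverse c ^ l)))"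

definition qpoch_ser :: "K \<Rightarrow> nat \<Rightarrow> nat \<Rightarrow> int \<Rightarrow> ser" where
  "qpoch_ser c i j k =
     (if 0 \<le> k then ser_prod_list (map (\<lambda>t. one_minus (c * qq ^ t) i j) [0..<nat k])
      else ser_prod_list (map (\<lambda>t. inv_one_minus (c * qq powi t) i j) [k..-1]))"

definition dyson :: "nat \<Rightarrow> (nat \<Rightarrow> nat) \<Rightarrow> ser" where
  "dyson n a = ser_prod_list
     [ser_mult (qpoch_ser 1 i j (int (a i))) (qpoch_ser qq j i (int (a j) - 1)).
        i \<leftarrow> [0..<n+1], j \<leftarrow> [i+1..<n+1]]"

definition qpochK :: "nat \<Rightarrow> K" where
  "qpochK k = (\<Prod>t<k. 1 - qq ^ (t + 1))"

definition pref_exp :: "(nat \<times> nat) set \<Rightarrow> nat \<Rightarrow> int" where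
  "pref_exp Q1 = (\<lambda>k. evec 0 1 k + (\<Sum>(i, j)\<in>Q1. evec j i k))"

definition beats :: "(nat \<times> nat) set \<Rightarrow> nat \<Rightarrow> nat \<Rightarrow> bool" where
  "beats Q1 i j \<longleftrightarrow> (i < j \<and> (i, j) \<notin> Q1) \<or> (j < i \<and> (j, i) \<in> Q1)"

definition tour_transitive :: "nat \<Rightarrow> (nat \<times> nat) set \<Rightarrow> bool" where
  "tour_transitive n Q1 \<longleftrightarrow>
     \<not> (\<exists>i\<in>{1..n}. \<exists>j\<in>{1..n}. \<exists>k\<in>{1..n}. beats Q1 i j \<and> beats Q1 j k \<and> beats Q1 k i)"

definition winner_perm :: "nat \<Rightarrow> (nat \<times> nat) set \<Rightarrow> (nat \<Rightarrow> nat) \<Rightarrow> bool" where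
  "winner_perm n Q1 \<sigma> \<longleftrightarrow> \<sigma> permutes {1..n} \<and> (\<forall>k\<in>{1..<n}. beats Q1 (\<sigma> k) (\<sigma> (k + 1)))"

end

theory Submission
  imports Defs
begin

text \<open>If some \<open>a j\<close> with \<open>1 \<le> j\<close> vanishes, take \<open>j\<close> maximal: every exponent of \<open>x_j\<close> in the
  product is at most \<open>- j\<close>, while the prefactor raises it by less than \<open>j\<close>; hence the constant term
  is zero, as is the right-hand side.

  Otherwise the product is a homogeneous Laurent polynomial, and its coefficient is read off by
  Lagrange interpolation on a grid \<open>x_k = q^\<alpha>_k\<close>, where \<open>\<alpha>_k\<close> ranges over \<open>{0..|a| - a_k}\<close> minus a
  set \<open>R_k\<close> of prescribed size (the out-degree of \<open>k\<close> in \<open>{2..n}\<close> for \<open>k \<ge> 2\<close>, \<open>n - 2\<close> for \<open>k = 1\<close>,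
  \<open>n + 1\<close> for \<open>k = 0\<close>). The product vanishes at a grid point unless the intervals
  \<open>[\<alpha>_k, \<alpha>_k + a_k)\<close> are disjoint, and then they tile \<open>[0, |a|)\<close>. The sets \<open>R_k\<close> can be chosen so
  that the tiling must start with the losers of the tournament. If the tournament is not transitive,
  the list of losers stops early and every further vertex is forbidden at the next position, so all
  terms vanish. If it is transitive, one tiling survives: the order is
  \<open>\<sigma> n, \<dots>, \<sigma> 3, 1, 0, \<sigma> 2\<close>, and its term telescopes to the stated product.\<close>

text \<open>Interpolation picks out one coefficient because the product is homogeneous: any other
  monomial has too small an exponent in some variable, and a Lagrange sum over enough nodes kills it
  there. Only the sizes of the node sets matter for this; powers of q are the right nodes because
  the q-factorials vanish once two intervals overlap. The range of \<alpha>_k exceeds the required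
  size by n - k + e_k, with e_k the exponent of x_k in the prefactor; that this surplus is an
  out-degree is what brings in the tournament. The surplus is spent on forbidding k the left ends of
  the vertices it beats, so that it must come after them. They also bar 0 from following 1 if
  \<open>a 1 = a (\<sigma> 2)\<close>, which accounts for the factor q^a_\<sigma>(1) -
  q^a_\<sigma>(2). The parameter \<open>a 0\<close> alone may vanish, and then the interval of 0 is
  empty and may share its left end with another; this is why vertex 0 is treated apart.\<close>

lemma qq_nonzero: "qq \<noteq> 0"
  by (simp add: qq_def Zero_fract_def eq_fract)

lemma qq_power: "qq ^ m = Fract (monom 1 m) 1"
  by (induction m) (simp_all add: qq_def One_fract_def monom_Suc one_pCons)

text \<open>Distinct exponents give distinct grid nodes, and the vanishing of a factor 1 - q^t x_i /
  x_j at a grid point becomes an equation between exponents.\<close>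

lemma qq_power_inject [simp]: "qq ^ i = qq ^ j \<longleftrightarrow> i = j"
  by (simp add: qq_power eq_fract monom_eq_iff')

lemma qq_power_eq_1_iff [simp]: "qq ^ i = 1 \<longleftrightarrow> i = 0"
  using qq_power_inject[of i 0] by (simp del: qq_power_inject)

subsection \<open>Finitely supported series\<close>

definition supp :: "ser \<Rightarrow> (nat \<Rightarrow> int) set" where
  "supp f = {\<beta>. f \<beta> \<noteq> 0}"

lemma not_in_suppD: "\<beta> \<notin> supp f \<Longrightarrow> f \<beta> = 0"
  by (simp add: supp_def)

lemma supp_ser_mult:
  assumes "\<gamma> \<in> supp (ser_mult f g)"
  obtains \<alpha> \<beta> where "\<alpha> \<in> supp f" "\<beta> \<in> supp g" "\<gamma> = (\<lambda>k. \<alpha> k + \<beta> k)"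
proof -
  have "{\<alpha>. f \<alpha> \<noteq> 0 \<and> g (\<lambda>k. \<gamma> k - \<alpha> k) \<noteq> 0} \<noteq> {}"
    using assms unfolding supp_def ser_mult_def mem_Collect_eq by (metis sum.empty)
  then obtain \<alpha> where "f \<alpha> \<noteq> 0" "g (\<lambda>k. \<gamma> k - \<alpha> k) \<noteq> 0" by blast
  with that[of \<alpha> "\<lambda>k. \<gamma> k - \<alpha> k"] show thesis by (auto simp: supp_def)
qed

lemma ser_mult_monom: "ser_mult (ser_monom e) f \<gamma> = f (\<lambda>k. \<gamma> k - e k)"
proof -
  have "{\<alpha>. ser_monom e \<alpha> \<noteq> 0 \<and> f (\<lambda>k. \<gamma> k - \<alpha> k) \<noteq> 0} =
        (if f (\<lambda>k. \<gamma> k - e k) \<noteq> 0 then {e} else {})"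
    by (auto simp: ser_monom_def)
  then show ?thesis by (simp add: ser_mult_def ser_monom_def)
qed

lemma finite_supp_mult:
  assumes "finite (supp f)" "finite (supp g)"
  shows "finite (supp (ser_mult f g))"
proof (rule finite_subset)
  show "supp (ser_mult f g) \<subseteq> (\<lambda>(\<alpha>, \<beta>). (\<lambda>k. \<alpha> k + \<beta> k)) ` (supp f \<times> supp g)"
    by (auto elim!: supp_ser_mult)
qed (use assms in auto)

lemma supp_one: "supp ser_one = {\<lambda>_. 0}"
  by (auto simp: supp_def ser_one_def)

lemma supp_one_minus: "supp (one_minus c i j) \<subseteq> {\<lambda>_. 0, evec i j}"
  by (auto simp: supp_def one_minus_def split: if_splits)

lemma finite_supp_one_minus: "finite (supp (one_minus c i j))"
  using supp_one_minus by (rule finite_subset) auto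

lemma finite_supp_prod_list:
  assumes "\<And>f. f \<in> set fs \<Longrightarrow> finite (supp f)"
  shows "finite (supp (ser_prod_list fs))"
  using assms by (induction fs) (auto simp: ser_prod_list_def supp_one finite_supp_mult)

lemma finite_supp_qpoch:
  assumes "0 \<le> k"
  shows "finite (supp (qpoch_ser c i j k))"
  using assms by (auto simp: qpoch_ser_def intro!: finite_supp_prod_list finite_supp_one_minus)

text \<open>Every q-factorial has nonnegative index here: \<open>a j - 1\<close> occurs only for
  \<open>j\<close> above some \<open>i\<close>, hence never for \<open>j = 0\<close>, so
  \<open>a 0\<close> may be zero.\<close>

lemma finite_supp_dyson:
  assumes "\<And>j. 1 \<le> j \<Longrightarrow> j \<le> n \<Longrightarrow> 1 \<le> a j"
  shows "finite (supp (dyson n a))"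
proof -
  have "finite (supp (ser_mult (qpoch_ser 1 i j (int (a i))) (qpoch_ser qq j i (int (a j) - 1))))"
    if "i < j" "j \<le> n" for i j
    using assms[of j] that by (auto intro!: finite_supp_mult finite_supp_qpoch)
  then show ?thesis
    unfolding dyson_def by (intro finite_supp_prod_list) (auto simp del: upt_Suc)
qed

subsection \<open>Evaluation\<close>

definition mono_eval :: "nat \<Rightarrow> (nat \<Rightarrow> K) \<Rightarrow> (nat \<Rightarrow> int) \<Rightarrow> K" where
  "mono_eval n x \<beta> = (\<Prod>k\<le>n. x k powi \<beta> k)"

text \<open>Meant for finite support only; on an infinite support the sum defaults to 0.\<close>

definition ser_eval :: "nat \<Rightarrow> (nat \<Rightarrow> K) \<Rightarrow> ser \<Rightarrow> K" where
  "ser_eval n x f = (\<Sum>\<beta>\<in>supp f. f \<beta> * mono_eval n x \<beta>)"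

lemma mono_eval_zero [simp]: "mono_eval n x (\<lambda>_. 0) = 1"
  by (simp add: mono_eval_def)

lemma mono_eval_add:
  assumes "\<And>k. k \<le> n \<Longrightarrow> x k \<noteq> 0"
  shows "mono_eval n x (\<lambda>k. \<alpha> k + \<beta> k) = mono_eval n x \<alpha> * mono_eval n x \<beta>"
  using assms by (simp add: mono_eval_def power_int_add prod.distrib)

lemma mono_eval_evec:
  assumes "i \<noteq> j" "i \<le> n" "j \<le> n"
  shows "mono_eval n x (evec i j) = x i / x j"
proof -
  have "mono_eval n x (evec i j) =
        (\<Prod>k\<le>n. (if k = i then x k else 1) * (if k = j then inverse (x k) else 1))"
    unfolding mono_eval_def evec_def using assms(1)
    by (intro prod.cong) (auto simp: power_int_minus)
  also have "\<dots> = x i / x j"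
    using assms by (simp add: prod.distrib prod.delta divide_inverse)
  finally show ?thesis .
qed

lemma ser_eval_superset:
  assumes "finite S" "supp f \<subseteq> S"
  shows "ser_eval n x f = (\<Sum>\<beta>\<in>S. f \<beta> * mono_eval n x \<beta>)"
  unfolding ser_eval_def using assms
  by (intro sum.mono_neutral_left) (auto simp: supp_def)

lemma ser_eval_mult:
  assumes fin: "finite (supp f)" "finite (supp g)" and x: "\<And>k. k \<le> n \<Longrightarrow> x k \<noteq> 0"
  shows "ser_eval n x (ser_mult f g) = ser_eval n x f * ser_eval n x g"
proof -
  define S where "S = (\<lambda>(\<alpha>, \<beta>). (\<lambda>k. \<alpha> k + \<beta> k)) ` (supp f \<times> supp g)"
  define C where "C \<gamma> = {\<alpha>. f \<alpha> \<noteq> 0 \<and> g (\<lambda>k. \<gamma> k - \<alpha> k) \<noteq> 0}" for \<gamma>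
  have finS: "finite S" using fin by (auto simp: S_def)
  have finC: "finite (C \<gamma>)" for \<gamma>
    by (rule finite_subset[OF _ fin(1)]) (auto simp: C_def supp_def)
  have "ser_eval n x (ser_mult f g) = (\<Sum>\<gamma>\<in>S. ser_mult f g \<gamma> * mono_eval n x \<gamma>)"
    using finS by (rule ser_eval_superset) (auto simp: S_def elim!: supp_ser_mult)
  also have "\<dots> = (\<Sum>\<gamma>\<in>S. \<Sum>\<alpha>\<in>C \<gamma>. f \<alpha> * g (\<lambda>k. \<gamma> k - \<alpha> k) * mono_eval n x \<gamma>)"
    by (simp add: ser_mult_def C_def sum_distrib_right)
  also have "\<dots> = (\<Sum>(\<gamma>, \<alpha>)\<in>Sigma S C. f \<alpha> * g (\<lambda>k. \<gamma> k - \<alpha> k) * mono_eval n x \<gamma>)"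
    using finS finC by (subst sum.Sigma) auto
  \<comment> \<open>The pairs (\<gamma>, \<alpha>) of the Cauchy product correspond to the pairs
    (\<alpha>, \<gamma> - \<alpha>) of exponents.\<close>
  also have "\<dots> = (\<Sum>(\<alpha>, \<beta>)\<in>supp f \<times> supp g. f \<alpha> * mono_eval n x \<alpha> * (g \<beta> * mono_eval n x \<beta>))"
  proof (rule sum.reindex_bij_witness[where
        i = "\<lambda>(\<alpha>, \<beta>). (\<lambda>k. \<alpha> k + \<beta> k, \<alpha>)" and j = "\<lambda>(\<gamma>, \<alpha>). (\<alpha>, \<lambda>k. \<gamma> k - \<alpha> k)"])
    fix p assume "p \<in> Sigma S C"
    then obtain \<gamma> \<alpha> where p: "p = (\<gamma>, \<alpha>)" by (cases p)
    have "mono_eval n x \<gamma> = mono_eval n x (\<lambda>k. \<alpha> k + (\<gamma> k - \<alpha> k))" by simp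
    also have "\<dots> = mono_eval n x \<alpha> * mono_eval n x (\<lambda>k. \<gamma> k - \<alpha> k)"
      by (rule mono_eval_add[OF x])
    finally show "(case case p of (\<gamma>, \<alpha>) \<Rightarrow> (\<alpha>, \<lambda>k. \<gamma> k - \<alpha> k) of
           (\<alpha>, \<beta>) \<Rightarrow> f \<alpha> * mono_eval n x \<alpha> * (g \<beta> * mono_eval n x \<beta>)) =
         (case p of (\<gamma>, \<alpha>) \<Rightarrow> f \<alpha> * g (\<lambda>k. \<gamma> k - \<alpha> k) * mono_eval n x \<gamma>)"
      by (simp add: p)
  qed (auto simp: S_def C_def supp_def image_iff)
  also have "\<dots> = ser_eval n x f * ser_eval n x g"
    by (simp add: ser_eval_def sum_product sum.cartesian_product)
  finally show ?thesis .
qed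

lemma ser_eval_one [simp]: "ser_eval n x ser_one = 1"
  unfolding ser_eval_def supp_one by (simp add: ser_one_def)

lemma ser_eval_prod_list:
  assumes "\<And>f. f \<in> set fs \<Longrightarrow> finite (supp f)" "\<And>k. k \<le> n \<Longrightarrow> x k \<noteq> 0"
  shows "ser_eval n x (ser_prod_list fs) = prod_list (map (ser_eval n x) fs)"
  using assms(1)
proof (induction fs)
  case (Cons f fs)
  have "finite (supp (ser_prod_list fs))"
    using Cons.prems by (intro finite_supp_prod_list) auto
  with Cons show ?case
    by (simp add: ser_prod_list_def ser_eval_mult assms(2))
qed (simp add: ser_prod_list_def)

lemma evec_nonzero: "i \<noteq> j \<Longrightarrow> evec i j \<noteq> (\<lambda>_. 0)"
  by (auto simp: evec_def fun_eq_iff)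

lemma ser_eval_one_minus:
  assumes "i \<noteq> j" "i \<le> n" "j \<le> n"
  shows "ser_eval n x (one_minus c i j) = 1 - c * (x i / x j)"
proof -
  have "ser_eval n x (one_minus c i j) =
      (\<Sum>\<beta>\<in>{\<lambda>_. 0, evec i j}. one_minus c i j \<beta> * mono_eval n x \<beta>)"
    using supp_one_minus by (rule ser_eval_superset[rotated]) auto
  also have "\<dots> = 1 - c * (x i / x j)"
    using evec_nonzero[OF assms(1)] evec_nonzero[OF assms(1), symmetric] assms
    by (simp add: one_minus_def mono_eval_evec)
  finally show ?thesis .
qed

lemma ser_eval_qpoch:
  assumes "i \<noteq> j" "i \<le> n" "j \<le> n" "\<And>k. k \<le> n \<Longrightarrow> x k \<noteq> 0"
  shows "ser_eval n x (qpoch_ser c i j (int m)) = (\<Prod>t<m. 1 - c * qq ^ t * (x i / x j))"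
proof -
  have "ser_eval n x (qpoch_ser c i j (int m)) =
        prod_list (map (ser_eval n x) (map (\<lambda>t. one_minus (c * qq ^ t) i j) [0..<m]))"
    using assms(4) ser_eval_prod_list[of "map (\<lambda>t. one_minus (c * qq ^ t) i j) [0..<m]" n x]
    by (simp add: qpoch_ser_def image_iff Bex_def) (metis finite_supp_one_minus)
  also have "\<dots> = prod_list (map (\<lambda>t. 1 - c * qq ^ t * (x i / x j)) [0..<m])"
    using assms(1-3) by (simp add: comp_def ser_eval_one_minus)
  also have "\<dots> = (\<Prod>t<m. 1 - c * qq ^ t * (x i / x j))"
    by (simp add: prod.distinct_set_conv_list[symmetric] atLeast0LessThan)
  finally show ?thesis .
qed

lemma prod_list_concat: "prod_list (concat xss) = prod_list (map prod_list xss)"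
  for xss :: "'a :: monoid_mult list list"
  by (induction xss) auto

lemma ser_eval_dyson:
  assumes a: "\<And>j. 1 \<le> j \<Longrightarrow> j \<le> n \<Longrightarrow> 1 \<le> a j" and x: "\<And>k. k \<le> n \<Longrightarrow> x k \<noteq> 0"
  shows "ser_eval n x (dyson n a) =
    (\<Prod>i\<le>n. \<Prod>j\<in>{i<..n}. (\<Prod>t<a i. 1 - qq ^ t * (x i / x j)) *
                          (\<Prod>t\<in>{1..<a j}. 1 - qq ^ t * (x j / x i)))"
proof -
  define F where "F i j = ser_mult (qpoch_ser 1 i j (int (a i))) (qpoch_ser qq j i (int (a j) - 1))" for i j
  define G where "G i j = (\<Prod>t<a i. 1 - qq ^ t * (x i / x j)) *
                          (\<Prod>t\<in>{1..<a j}. 1 - qq ^ t * (x j / x i))" for i j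
  have fin: "finite (supp (F i j))" if "i < j" "j \<le> n" for i j
    using a[of j] that by (auto simp: F_def intro!: finite_supp_mult finite_supp_qpoch)
  have eval: "ser_eval n x (F i j) = G i j" if "i < j" "j \<le> n" for i j
  proof -
    from that a[of j] have aj: "int (a j) - 1 = int (a j - 1)" by auto
    have "(\<Prod>t<a j - 1. 1 - qq * qq ^ t * (x j / x i)) = (\<Prod>t\<in>{1..<a j}. 1 - qq ^ t * (x j / x i))"
      by (rule prod.reindex_bij_witness[where i = "\<lambda>t. t - 1" and j = Suc]) auto
    with that x show ?thesis unfolding F_def G_def aj
      by (subst ser_eval_mult) (auto simp: ser_eval_qpoch finite_supp_qpoch)
  qed
  have "ser_eval n x (dyson n a) = prod_list [ser_eval n x (F i j). i \<leftarrow> [0..<n+1], j \<leftarrow> [i+1..<n+1]]"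
    unfolding dyson_def F_def[symmetric]
    by (subst ser_eval_prod_list) (auto simp: x fin map_concat comp_def)
  also have "[ser_eval n x (F i j). i \<leftarrow> [0..<n+1], j \<leftarrow> [i+1..<n+1]] =
             [G i j. i \<leftarrow> [0..<n+1], j \<leftarrow> [i+1..<n+1]]"
    by (intro arg_cong[where f = concat] map_cong) (auto simp: eval)
  also have "prod_list \<dots> = (\<Prod>i\<in>{0..<n+1}. \<Prod>j\<in>{i+1..<n+1}. G i j)"
    by (simp add: prod_list_concat comp_def prod.distinct_set_conv_list[symmetric] del: upt_Suc)
  also have "\<dots> = (\<Prod>i\<le>n. \<Prod>j\<in>{i<..n}. G i j)"
    by (intro prod.cong) auto
  finally show ?thesis by (simp add: G_def)
qed

subsection \<open>Bounds for exponents\<close>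

text \<open>Bounding a functional instead of one coordinate lets the same induction serve a single
  exponent, the total degree and their negatives, that is, upper as well as lower bounds.\<close>

definition additive_functional :: "((nat \<Rightarrow> int) \<Rightarrow> int) \<Rightarrow> bool" where
  "additive_functional \<phi> \<longleftrightarrow> (\<forall>\<alpha> \<beta>. \<phi> (\<lambda>k. \<alpha> k + \<beta> k) = \<phi> \<alpha> + \<phi> \<beta>)"

definition exps_le :: "((nat \<Rightarrow> int) \<Rightarrow> int) \<Rightarrow> ser \<Rightarrow> int \<Rightarrow> bool" where
  "exps_le \<phi> f B \<longleftrightarrow> (\<forall>\<beta>\<in>supp f. \<phi> \<beta> \<le> B)"

lemma additive_functional_zero: "additive_functional \<phi> \<Longrightarrow> \<phi> (\<lambda>_. 0) = 0"
  unfolding additive_functional_def by (elim allE[of _ "\<lambda>_. 0"]) simp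

lemma additive_functional_scale:
  assumes "additive_functional \<phi>"
  shows "\<phi> (\<lambda>k. int l * \<beta> k) = int l * \<phi> \<beta>"
proof (induction l)
  case (Suc l)
  have "\<phi> (\<lambda>k. int (Suc l) * \<beta> k) = \<phi> (\<lambda>k. \<beta> k + int l * \<beta> k)"
    by (simp add: algebra_simps)
  also have "\<dots> = \<phi> \<beta> + int l * \<phi> \<beta>"
    using assms Suc unfolding additive_functional_def by simp
  finally show ?case by (simp add: algebra_simps)
qed (simp add: additive_functional_zero[OF assms])

text \<open>A nonzero coefficient of the product needs at least one pair of exponents, so no
  finiteness is required. The bounds thus also hold for the infinite series that arise from a zero
  parameter.\<close>

lemma exps_le_mult:
  assumes "additive_functional \<phi>" "exps_le \<phi> f B" "exps_le \<phi> g C"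
  shows "exps_le \<phi> (ser_mult f g) (B + C)"
  unfolding exps_le_def
proof
  fix \<gamma> assume "\<gamma> \<in> supp (ser_mult f g)"
  then obtain \<alpha> \<beta> where "\<alpha> \<in> supp f" "\<beta> \<in> supp g" "\<gamma> = (\<lambda>k. \<alpha> k + \<beta> k)"
    by (rule supp_ser_mult)
  with assms show "\<phi> \<gamma> \<le> B + C"
    unfolding exps_le_def additive_functional_def by (metis add_mono)
qed

lemma exps_le_mono: "exps_le \<phi> f B \<Longrightarrow> B \<le> C \<Longrightarrow> exps_le \<phi> f C"
  unfolding exps_le_def by force

lemma exps_le_prod_list:
  assumes "additive_functional \<phi>" "\<And>f. f \<in> set xs \<Longrightarrow> exps_le \<phi> (F f) (B f)"
  shows "exps_le \<phi> (ser_prod_list (map F xs)) (sum_list (map B xs))"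
  using assms(2)
proof (induction xs)
  case Nil
  then show ?case
    by (simp add: ser_prod_list_def exps_le_def supp_one additive_functional_zero[OF assms(1)])
next
  case (Cons f xs)
  then show ?case
    using exps_le_mult[OF assms(1), of "F f" "B f" "ser_prod_list (map F xs)"]
    by (simp add: ser_prod_list_def)
qed

lemma exps_le_one_minus:
  assumes "additive_functional \<phi>"
  shows "exps_le \<phi> (one_minus c i j) (max 0 (\<phi> (evec i j)))"
  unfolding exps_le_def using supp_one_minus[of c i j]
  by (fastforce simp: additive_functional_zero[OF assms])

lemma exps_le_qpoch:
  assumes "additive_functional \<phi>"
  shows "exps_le \<phi> (qpoch_ser c i j (int m)) (int m * max 0 (\<phi> (evec i j)))"
proof -
  have "exps_le \<phi> (qpoch_ser c i j (int m)) (sum_list (map (\<lambda>t. max 0 (\<phi> (evec i j))) [0..<m]))"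
    unfolding qpoch_ser_def
    by (simp del: map_replicate_const sum_list_replicate
        add: exps_le_prod_list[OF assms exps_le_one_minus[OF assms]])
  then show ?thesis by (simp add: map_replicate_const sum_list_replicate)
qed

text \<open>The index -1 comes from \<open>a j = 0\<close>. The inverse of 1 - d x_j / x_i is
  expanded in x_i / x_j and its powers start at \<open>l = 1\<close>: the missing constant term
  allows a bound below 0.\<close>

lemma exps_le_inverse_factor:
  assumes "additive_functional \<phi>" "\<phi> (evec i j) \<le> 0" "i < j"
  shows "exps_le \<phi> (qpoch_ser c j i (- 1)) (\<phi> (evec i j))"
proof -
  have "exps_le \<phi> (inv_one_minus d j i) (\<phi> (evec i j))" for d
    unfolding exps_le_def
  proof
    fix \<beta> assume "\<beta> \<in> supp (inv_one_minus d j i)"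
    then have "(\<Sum>l\<in>{l::nat. 1 \<le> l \<and> \<beta> = (\<lambda>k. int l * evec i j k)}. - (inverse d ^ l)) \<noteq> 0"
      using assms(3) by (simp add: supp_def inv_one_minus_def)
    then have "{l::nat. 1 \<le> l \<and> \<beta> = (\<lambda>k. int l * evec i j k)} \<noteq> {}"
      by (metis (no_types, lifting) sum.empty)
    then obtain l :: nat where l: "1 \<le> l" "\<beta> = (\<lambda>k. int l * evec i j k)" by blast
    then have "\<phi> \<beta> = int l * \<phi> (evec i j)"
      by (simp add: additive_functional_scale[OF assms(1)])
    also have "\<dots> \<le> 1 * \<phi> (evec i j)"
      using l assms(2) by (intro mult_right_mono_neg) auto
    finally show "\<phi> \<beta> \<le> \<phi> (evec i j)" by simp
  qed
  from exps_le_prod_list[where xs = "[- 1]" and B = "\<lambda>_. \<phi> (evec i j)" and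
      F = "\<lambda>t. inv_one_minus (c * qq powi t) j i", OF assms(1) this]
  show ?thesis by (simp add: qpoch_ser_def)
qed

lemma sum_list_of_concat: "sum_list (concat xss) = sum_list (map sum_list xss)"
  for xss :: "'a :: monoid_add list list"
  by (induction xss) auto

lemma exps_le_dyson:
  assumes "additive_functional \<phi>"
    and "\<And>i j. i < j \<Longrightarrow> j \<le> n \<Longrightarrow>
      exps_le \<phi> (ser_mult (qpoch_ser 1 i j (int (a i))) (qpoch_ser qq j i (int (a j) - 1))) (B i j)"
  shows "exps_le \<phi> (dyson n a) (\<Sum>i\<le>n. \<Sum>j\<in>{i<..n}. B i j)"
proof -
  define F where "F p = (case p of (i, j) \<Rightarrow>
    ser_mult (qpoch_ser 1 i j (int (a i))) (qpoch_ser qq j i (int (a j) - 1)))" for p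
  define xs where "xs = [(i, j). i \<leftarrow> [0..<n+1], j \<leftarrow> [i+1..<n+1]]"
  have "dyson n a = ser_prod_list (map F xs)"
    by (simp add: dyson_def F_def xs_def map_concat comp_def del: upt_Suc)
  moreover have "exps_le \<phi> (ser_prod_list (map F xs)) (sum_list (map (\<lambda>(i, j). B i j) xs))"
    by (rule exps_le_prod_list[OF assms(1)]) (auto simp: F_def xs_def assms(2) simp del: upt_Suc)
  moreover have "sum_list (map (\<lambda>(i, j). B i j) xs) = (\<Sum>i\<in>{0..<n+1}. \<Sum>j\<in>{i+1..<n+1}. B i j)"
    by (simp add: xs_def map_concat comp_def sum_list_of_concat sum.distinct_set_conv_list[symmetric] del: upt_Suc)
  moreover have "\<dots> = (\<Sum>i\<le>n. \<Sum>j\<in>{i<..n}. B i j)"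
    by (intro sum.cong) auto
  ultimately show ?thesis by simp
qed

lemma exps_le_dyson_factor:
  assumes "additive_functional \<phi>" "1 \<le> (a j :: nat)"
  shows "exps_le \<phi> (ser_mult (qpoch_ser 1 i j (int (a i))) (qpoch_ser qq j i (int (a j) - 1)))
    (int (a i) * max 0 (\<phi> (evec i j)) + int (a j - 1) * max 0 (\<phi> (evec j i)))"
proof -
  from assms(2) have "int (a j) - 1 = int (a j - 1)" by simp
  then show ?thesis
    by (metis exps_le_mult exps_le_qpoch assms(1))
qed

lemma additive_functional_eval: "additive_functional (\<lambda>\<beta>. c * \<beta> k)"
  by (simp add: additive_functional_def algebra_simps)

lemma additive_functional_total: "additive_functional (\<lambda>\<beta>. c * (\<Sum>k\<le>n. \<beta> k))"
  by (simp add: additive_functional_def sum.distrib algebra_simps)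

lemma sum_evec: "i \<le> n \<Longrightarrow> j \<le> n \<Longrightarrow> (\<Sum>k\<le>n. evec i j k) = 0"
  by (simp add: evec_def sum_subtractf)

context
  fixes n :: nat and a :: "nat \<Rightarrow> nat"
  assumes a_pos: "\<And>j. 1 \<le> j \<Longrightarrow> j \<le> n \<Longrightarrow> 1 \<le> a j"
begin

text \<open>The total degree vanishes on ratios of variables. Using both signs of \<open>c\<close>
  turns an upper bound into an equality.\<close>

lemma dyson_exps_total:
  assumes "\<beta> \<in> supp (dyson n a)"
  shows "(\<Sum>k\<le>n. \<beta> k) = 0"
proof -
  have "c * (\<Sum>k\<le>n. \<beta> k) \<le> 0" for c
  proof -
    have "exps_le (\<lambda>\<beta>. c * (\<Sum>k\<le>n. \<beta> k)) (dyson n a) (\<Sum>i\<le>n. \<Sum>j\<in>{i<..n}. 0)"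
    proof (rule exps_le_dyson[OF additive_functional_total])
      fix i j assume ij: "i < j" "j \<le> n"
      then have "1 \<le> a j" using a_pos by simp
      from exps_le_dyson_factor[where a = a and j = j and i = i and \<phi> = "\<lambda>\<beta>. c * (\<Sum>k\<le>n. \<beta> k)", OF additive_functional_total this] ij 
      show "exps_le (\<lambda>\<beta>. c * (\<Sum>k\<le>n. \<beta> k))
              (ser_mult (qpoch_ser 1 i j (int (a i))) (qpoch_ser qq j i (int (a j) - 1))) 0"
        by (simp add: sum_evec)
    qed
    with assms show ?thesis by (simp add: exps_le_def)
  qed
  from this[of 1] this[of "-1"] show ?thesis by simp
qed

text \<open>Exponent vectors are functions on all of \<open>nat\<close>, so recognizing the target
  vector also requires its entries beyond \<open>n\<close>.\<close>

lemma dyson_exps_outside: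
  assumes "\<beta> \<in> supp (dyson n a)" "n < k"
  shows "\<beta> k = 0"
proof -
  have "c * \<beta> k \<le> 0" for c
  proof -
    have "exps_le (\<lambda>\<beta>. c * \<beta> k) (dyson n a) (\<Sum>i\<le>n. \<Sum>j\<in>{i<..n}. 0)"
    proof (rule exps_le_dyson[OF additive_functional_eval])
      fix i j assume ij: "i < j" "j \<le> n"
      then have "1 \<le> a j" using a_pos by simp
      from exps_le_dyson_factor[where a = a and j = j and i = i and \<phi> = "\<lambda>\<beta>. c * \<beta> k", OF additive_functional_eval this] ij assms(2)
      show "exps_le (\<lambda>\<beta>. c * \<beta> k)
              (ser_mult (qpoch_ser 1 i j (int (a i))) (qpoch_ser qq j i (int (a j) - 1))) 0"
        by (simp add: evec_def)
    qed
    with assms show ?thesis by (simp add: exps_le_def)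
  qed
  from this[of 1] this[of "-1"] show ?thesis by simp
qed

text \<open>In each pair containing x_k only one of the two q-factorials has x_k in the denominator:
  the one with \<open>a i\<close> factors for i < k, and the one with \<open>a j - 1\<close> factors
  for j > k.\<close>

lemma dyson_exps_lower:
  assumes "\<beta> \<in> supp (dyson n a)" "k \<le> n"
  shows "- \<beta> k \<le> int ((\<Sum>i<k. a i) + (\<Sum>j\<in>{k<..n}. a j - 1))"
proof -
  let ?B = "\<lambda>i j. (if j = k then int (a i) else 0) + (if i = k then int (a j - 1) else 0)"
  have "exps_le (\<lambda>\<beta>. - 1 * \<beta> k) (dyson n a) (\<Sum>i\<le>n. \<Sum>j\<in>{i<..n}. ?B i j)"
  proof (rule exps_le_dyson[OF additive_functional_eval])
    fix i j assume ij: "i < j" "j \<le> n"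
    then have "1 \<le> a j" using a_pos by simp
      from exps_le_dyson_factor[where a = a and j = j and i = i and \<phi> = "\<lambda>\<beta>. - 1 * \<beta> k", OF additive_functional_eval this] ij
    show "exps_le (\<lambda>\<beta>. - 1 * \<beta> k)
            (ser_mult (qpoch_ser 1 i j (int (a i))) (qpoch_ser qq j i (int (a j) - 1))) (?B i j)"
      by (elim exps_le_mono) (auto simp: evec_def)
  qed
  also have "(\<Sum>i\<le>n. \<Sum>j\<in>{i<..n}. ?B i j) =
    (\<Sum>i\<le>n. if i < k then int (a i) else 0) +
    (\<Sum>i\<le>n. if i = k then \<Sum>j\<in>{i<..n}. int (a j - 1) else 0)"
    using assms(2) unfolding sum.distrib by (intro arg_cong2[where f = "(+)"] sum.cong) auto
  also have "\<dots> = int ((\<Sum>i<k. a i) + (\<Sum>j\<in>{k<..n}. a j - 1))"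
  proof -
    have "{i. i \<le> n \<and> i < k} = {..<k}" using assms(2) by auto
    then show ?thesis using assms(2) by (simp add: sum.If_cases Int_def)
  qed
  finally show ?thesis using assms(1) by (simp add: exps_le_def)
qed

end

subsection \<open>Coefficients by interpolation on a grid\<close>

text \<open>The sum is the coefficient of degree \<open>card A - 1\<close> in the Lagrange
  interpolant of x^r on the nodes; as r < \<open>card A\<close>, the interpolant is x^r
  itself.\<close>

lemma lagrange_power_sum:
  fixes x :: "'b \<Rightarrow> 'a :: field"
  assumes fin: "finite A" and inj: "inj_on x A" and r: "r < card A"
  shows "(\<Sum>m\<in>A. x m ^ r / (\<Prod>m'\<in>A - {m}. x m - x m')) = (if Suc r = card A then 1 else 0)"
proof -
  define w where "w m = (\<Prod>m'\<in>A - {m}. x m - x m')" for m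
  define L where "L m = (\<Prod>m'\<in>A - {m}. [:- x m', 1:])" for m
  define p where "p = (\<Sum>m\<in>A. smult (x m ^ r / w m) (L m))"
  have degL: "degree (L m) = card A - 1" and leadL: "coeff (L m) (card A - 1) = 1" if "m \<in> A" for m
  proof -
    show 1: "degree (L m) = card A - 1"
      using that fin unfolding L_def by (subst degree_prod_eq_sum_degree) auto
    have "lead_coeff (L m) = 1" unfolding L_def by (simp add: lead_coeff_prod)
    then show "coeff (L m) (card A - 1) = 1" by (simp add: 1)
  qed
  have w0: "w m \<noteq> 0" if "m \<in> A" for m
    using that fin inj by (auto simp: w_def inj_on_def)
  have polyL: "poly (L m) (x m') = (if m' = m then w m else 0)" if "m \<in> A" "m' \<in> A" for m m'
    using that fin by (auto simp: L_def w_def poly_prod intro!: prod.cong)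
  have val: "poly p (x m') = x m' ^ r" if "m' \<in> A" for m'
  proof -
    have "poly p (x m') = (\<Sum>m\<in>A. x m ^ r / w m * (if m' = m then w m else 0))"
      unfolding p_def poly_sum using that by (intro sum.cong) (auto simp: polyL)
    also have "\<dots> = (\<Sum>m\<in>A. if m' = m then x m ^ r else 0)"
      using w0 by (intro sum.cong) auto
    also have "\<dots> = x m' ^ r" using fin that by simp
    finally show ?thesis .
  qed
  have "p = monom 1 r"
  proof (rule ccontr)
    assume ne: "p \<noteq> monom 1 r"
    have "degree p \<le> card A - 1"
      unfolding p_def by (rule degree_sum_le) (use fin degL in auto)
    then have "degree (p - monom 1 r) < card A"
      using r by (intro le_less_trans[OF degree_diff_le_max]) (auto simp: degree_monom_eq)
    moreover have "card A \<le> degree (p - monom 1 r)"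
    proof -
      have "card A = card (x ` A)" using inj by (simp add: card_image)
      also have "\<dots> \<le> card {z. poly (p - monom 1 r) z = 0}"
        using ne by (intro card_mono poly_roots_finite) (auto simp: val poly_monom)
      also have "\<dots> \<le> degree (p - monom 1 r)"
        using ne by (intro card_poly_roots_bound) auto
      finally show ?thesis .
    qed
    ultimately show False by simp
  qed
  then have "coeff p (card A - 1) = (if Suc r = card A then 1 else 0)"
    using r by auto
  moreover have "coeff p (card A - 1) = (\<Sum>m\<in>A. x m ^ r / w m)"
    unfolding p_def coeff_sum by (intro sum.cong) (simp_all add: leadL del: One_nat_def)
  ultimately show ?thesis by (simp add: w_def)
qed

text \<open>For \<open>m\<close> in \<open>A\<close>, the derivative at \<open>qq ^ m\<close> of the
  monic polynomial whose roots are the nodes.\<close>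

definition grid_weight :: "nat set \<Rightarrow> nat \<Rightarrow> K" where
  "grid_weight A m = (\<Prod>m'\<in>A - {m}. qq ^ m - qq ^ m')"

text \<open>The largest power of 1 / x_k that \<open>dyson_exps_lower\<close> allows; multiplication
  by this power of x_k clears the denominators.\<close>

definition dyson_shift :: "nat \<Rightarrow> (nat \<Rightarrow> nat) \<Rightarrow> nat \<Rightarrow> nat" where
  "dyson_shift n a k = (\<Sum>i<k. a i) + (\<Sum>j\<in>{k<..n}. a j - 1)"

text \<open>The coefficient formula belonging to the combinatorial Nullstellensatz. For each
  monomial the sum over the grid factors coordinatewise, and \<open>card (A k)\<close> is one more
  than the shifted exponent of the wanted monomial, which therefore gets weight 1.\<close>

lemma ct_dyson_grid:
  fixes A :: "nat \<Rightarrow> nat set" and e :: "nat \<Rightarrow> int"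
  assumes a_pos: "\<And>j. 1 \<le> j \<Longrightarrow> j \<le> n \<Longrightarrow> 1 \<le> a j"
    and e: "(\<Sum>k\<le>n. e k) = 0" "\<And>k. n < k \<Longrightarrow> e k = 0"
    and A: "\<And>k. k \<le> n \<Longrightarrow> finite (A k)"
    and card: "\<And>k. k \<le> n \<Longrightarrow> int (card (A k)) = int (dyson_shift n a k) - e k + 1"
  shows "ct (ser_mult (ser_monom e) (dyson n a)) =
    (\<Sum>\<alpha>\<in>PiE {..n} A. ser_eval n (\<lambda>k. qq ^ \<alpha> k) (dyson n a) *
       (\<Prod>k\<le>n. (qq ^ \<alpha> k) ^ dyson_shift n a k / grid_weight (A k) (\<alpha> k)))"
proof -
  define f where "f = dyson n a"
  define N where "N = dyson_shift n a"
  define h where "h k r = (\<Sum>m\<in>A k. (qq ^ m) ^ r / grid_weight (A k) m)" for k r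
  have h: "h k r = (if Suc r = card (A k) then 1 else 0)" if "k \<le> n" "r < card (A k)" for k r
    unfolding h_def grid_weight_def using that
    by (intro lagrange_power_sum A) (auto simp: inj_on_def)
  have fin: "finite (supp f)" unfolding f_def by (rule finite_supp_dyson[OF a_pos])
  have lower: "0 \<le> \<beta> k + int (N k)" if "\<beta> \<in> supp f" "k \<le> n" for \<beta> k
    using dyson_exps_lower[OF a_pos that[unfolded f_def]] unfolding N_def dyson_shift_def by linarith
  have key: "(\<Prod>k\<le>n. h k (nat (\<beta> k + int (N k)))) = (if \<beta> = (\<lambda>k. - e k) then 1 else 0)"
    if \<beta>: "\<beta> \<in> supp f" for \<beta>
  proof (cases "\<beta> = (\<lambda>k. - e k)")
    case True
    have "h k (nat (\<beta> k + int (N k))) = 1" if "k \<le> n" for k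
      using lower[OF \<beta> that] card[OF that] h[OF that, of "nat (\<beta> k + int (N k))"]
      by (auto simp: True N_def)
    with True show ?thesis by simp
  next
    case False
    \<comment> \<open>Both exponent vectors sum to 0, so distinct ones cannot dominate each other.
      In a coordinate where \<beta> falls short the Lagrange sum is 0, whatever the other
      coordinates give.\<close>
    have "\<exists>k\<le>n. \<beta> k < - e k"
    proof (rule ccontr)
      assume "\<not> ?thesis"
      then have ge: "\<And>k. k \<le> n \<Longrightarrow> - e k \<le> \<beta> k" by force
      have tot: "(\<Sum>k\<le>n. \<beta> k + e k) = 0"
        using dyson_exps_total[OF a_pos \<beta>[unfolded f_def]] e(1) by (simp add: sum.distrib)
      have "\<beta> k + e k = 0" if "k \<le> n" for k
        using tot that by (subst (asm) sum_nonneg_eq_0_iff) (use ge in force)+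
      then have "\<beta> k = - e k" for k
        using dyson_exps_outside[OF a_pos \<beta>[unfolded f_def], of k] e(2)[of k]
        by (cases "k \<le> n") force+
      with False show False by auto
    qed
    then obtain k where k: "k \<le> n" "\<beta> k < - e k" by blast
    with lower[OF \<beta> k(1)] card[OF k(1)] h[OF k(1), of "nat (\<beta> k + int (N k))"]
    have "h k (nat (\<beta> k + int (N k))) = 0" by (auto simp: N_def split: if_splits)
    with k(1) False show ?thesis by (auto intro!: prod_zero)
  qed
  have "(\<Sum>\<alpha>\<in>PiE {..n} A. ser_eval n (\<lambda>k. qq ^ \<alpha> k) f *
       (\<Prod>k\<le>n. (qq ^ \<alpha> k) ^ N k / grid_weight (A k) (\<alpha> k))) =
    (\<Sum>\<alpha>\<in>PiE {..n} A. \<Sum>\<beta>\<in>supp f. f \<beta> *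
       (\<Prod>k\<le>n. (qq ^ \<alpha> k) ^ nat (\<beta> k + int (N k)) / grid_weight (A k) (\<alpha> k)))"
    (is "?lhs = _")
  proof (rule sum.cong[OF refl])
    fix \<alpha>
    have "mono_eval n (\<lambda>k. qq ^ \<alpha> k) \<beta> * (\<Prod>k\<le>n. (qq ^ \<alpha> k) ^ N k / grid_weight (A k) (\<alpha> k)) =
      (\<Prod>k\<le>n. (qq ^ \<alpha> k) ^ nat (\<beta> k + int (N k)) / grid_weight (A k) (\<alpha> k))"
      if \<beta>: "\<beta> \<in> supp f" for \<beta>
    proof -
      have "(qq ^ \<alpha> k) powi \<beta> k * (qq ^ \<alpha> k) ^ N k = (qq ^ \<alpha> k) ^ nat (\<beta> k + int (N k))"
        if "k \<le> n" for k
      proof -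
        have "(qq ^ \<alpha> k) powi \<beta> k * (qq ^ \<alpha> k) ^ N k = (qq ^ \<alpha> k) powi (\<beta> k + int (N k))"
          by (simp add: power_int_add qq_nonzero)
        also have "\<dots> = (qq ^ \<alpha> k) ^ nat (\<beta> k + int (N k))"
          using lower[OF \<beta> that] by (simp add: power_int_def)
        finally show ?thesis .
      qed
      then show ?thesis
        unfolding mono_eval_def prod.distrib[symmetric] by (intro prod.cong) auto
    qed
    then show "ser_eval n (\<lambda>k. qq ^ \<alpha> k) f * (\<Prod>k\<le>n. (qq ^ \<alpha> k) ^ N k / grid_weight (A k) (\<alpha> k)) =
      (\<Sum>\<beta>\<in>supp f. f \<beta> *
       (\<Prod>k\<le>n. (qq ^ \<alpha> k) ^ nat (\<beta> k + int (N k)) / grid_weight (A k) (\<alpha> k)))"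
      unfolding ser_eval_def sum_distrib_right mult.assoc by (intro sum.cong) auto
  qed
  also have "\<dots> = (\<Sum>\<beta>\<in>supp f. f \<beta> * (\<Sum>\<alpha>\<in>PiE {..n} A.
       \<Prod>k\<le>n. (qq ^ \<alpha> k) ^ nat (\<beta> k + int (N k)) / grid_weight (A k) (\<alpha> k)))"
    by (subst sum.swap) (simp add: sum_distrib_left)
  also have "\<dots> = (\<Sum>\<beta>\<in>supp f. f \<beta> * (\<Prod>k\<le>n. h k (nat (\<beta> k + int (N k)))))"
    unfolding h_def using A by (subst prod_sum_PiE) auto
  also have "\<dots> = (\<Sum>\<beta>\<in>supp f. if \<beta> = (\<lambda>k. - e k) then f \<beta> else 0)"
    by (intro sum.cong) (auto simp: key)
  also have "\<dots> = f (\<lambda>k. - e k)"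
    using fin by (auto simp: supp_def)
  also have "\<dots> = ct (ser_mult (ser_monom e) (dyson n a))"
    by (simp add: ct_def ser_mult_monom f_def)
  finally show ?thesis by (simp add: f_def N_def)
qed

subsection \<open>The exponents of the monomial prefactor\<close>

context
  fixes n :: nat and Q1 :: "(nat \<times> nat) set"
  assumes n2: "2 \<le> n" and Q1: "Q1 \<subseteq> {(i, j). 2 \<le> i \<and> i < j \<and> j \<le> n}"
begin

lemma finite_Q1: "finite Q1"
  by (rule finite_subset[of _ "{..n} \<times> {..n}"]) (use Q1 in auto)

lemma finite_Q1_sections [simp]: "finite {i. (i, k) \<in> Q1}" "finite {j. (k, j) \<in> Q1}"
  by (rule finite_subset[of _ "{..n}"], use Q1 in auto)+

lemma pref_exp_le_1:
  "pref_exp Q1 0 = 1" "pref_exp Q1 1 = -1"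
proof -
  have "(\<Sum>(i, j)\<in>Q1. evec j i k) = 0" if "k \<le> 1" for k
    using Q1 that by (intro sum.neutral) (auto simp: evec_def)
  from this[of 0] this[of 1] show "pref_exp Q1 0 = 1" "pref_exp Q1 1 = -1"
    by (simp_all add: pref_exp_def) (simp_all add: evec_def)
qed

lemma pref_exp_card:
  assumes "2 \<le> k"
  shows "pref_exp Q1 k = int (card {i. (i, k) \<in> Q1}) - int (card {j. (k, j) \<in> Q1})"
proof -
  have c: "card {p \<in> Q1. snd p = k} = card {i. (i, k) \<in> Q1}"
    by (rule bij_betw_same_card[of fst]) (auto simp: bij_betw_def inj_on_def image_iff)
  have d: "card {p \<in> Q1. fst p = k} = card {j. (k, j) \<in> Q1}"
    by (rule bij_betw_same_card[of snd]) (auto simp: bij_betw_def inj_on_def image_iff)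
  have "pref_exp Q1 k = (\<Sum>p\<in>Q1. (if snd p = k then 1 else 0) - (if fst p = k then 1 else 0))"
    using assms unfolding pref_exp_def by (auto simp: evec_def case_prod_beta intro!: sum.cong)
  also have "\<dots> = int (card {p \<in> Q1. snd p = k}) - int (card {p \<in> Q1. fst p = k})"
    using finite_Q1 by (simp add: sum_subtractf sum.If_cases Int_def)
  finally show ?thesis by (simp add: c d)
qed

lemma pref_exp_outside: "n < k \<Longrightarrow> pref_exp Q1 k = 0"
proof -
  assume "n < k"
  with Q1 have "{i. (i, k) \<in> Q1} = {}" "{j. (k, j) \<in> Q1} = {}" by auto
  with \<open>n < k\<close> n2 show ?thesis by (simp add: pref_exp_card)
qed

lemma sum_pref_exp: "(\<Sum>k\<le>n. pref_exp Q1 k) = 0"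
proof -
  have "(\<Sum>k\<le>n. pref_exp Q1 k) = (\<Sum>k\<le>n. evec 0 1 k) + (\<Sum>p\<in>Q1. \<Sum>k\<le>n. evec (snd p) (fst p) k)"
    unfolding pref_exp_def sum.distrib by (subst sum.swap) (simp add: case_prod_beta)
  also have "(\<Sum>p\<in>Q1. \<Sum>k\<le>n. evec (snd p) (fst p) k) = 0"
    using Q1 by (intro sum.neutral ballI sum_evec) auto
  finally show ?thesis using n2 by (simp add: sum_evec)
qed

text \<open>Without \<open>Q1\<close>, vertex k beats the n - k later ones; a pair (k, j) in
  \<open>Q1\<close> costs one win and a pair (i, k) gains one, exactly as the prefactor changes the
  exponent of x_k.\<close>

lemma pref_exp_outdegree:
  assumes "2 \<le> k" "k \<le> n"
  shows "int (card {j\<in>{2..n}. beats Q1 k j}) = int n - int k + pref_exp Q1 k"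
proof -
  have "{j\<in>{2..n}. beats Q1 k j} = ({k<..n} - {j. (k, j) \<in> Q1}) \<union> {i. (i, k) \<in> Q1}"
    using Q1 assms by (auto simp: beats_def)
  moreover have "card \<dots> = card ({k<..n} - {j. (k, j) \<in> Q1}) + card {i. (i, k) \<in> Q1}"
    using Q1 by (intro card_Un_disjoint) auto
  moreover have "card ({k<..n} - {j. (k, j) \<in> Q1}) = (n - k) - card {j. (k, j) \<in> Q1}"
    using Q1 by (subst card_Diff_subset) auto
  moreover have "card {j. (k, j) \<in> Q1} \<le> card {k<..n}"
    using Q1 by (intro card_mono) auto
  ultimately show ?thesis using assms pref_exp_card[of k] by simp
qed

lemma pref_exp_less:
  assumes "1 \<le> k"
  shows "pref_exp Q1 k < int k"
proof (cases "k = 1")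
  case False
  have "card {i. (i, k) \<in> Q1} \<le> card {2..<k}"
    using Q1 by (intro card_mono) auto
  with False assms pref_exp_card[of k] show ?thesis by simp
qed (use pref_exp_le_1 in simp)

text \<open>Maximality of \<open>j\<close> excludes inverses of 1 - x_k / x_j with k > j, whose
  expansion in x_j / x_k would raise the exponent of x_j. Each of the \<open>j\<close> pairs (i, j)
  with i < j brings an inverse factor that lowers it by at least 1.\<close>

lemma ct_zero_parameter:
  assumes "1 \<le> l" "l \<le> n" "a l = 0"
  shows "ct (ser_mult (ser_monom (pref_exp Q1)) (dyson n a)) = 0"
proof -
  define j where "j = Max {j. j \<le> n \<and> a j = 0}"
  have fin: "finite {j. j \<le> n \<and> a j = 0}" by simp
  have "j \<in> {j. j \<le> n \<and> a j = 0}"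
    unfolding j_def using assms by (intro Max_in[OF fin]) auto
  moreover have max: "i \<le> j" if "i \<le> n" "a i = 0" for i
    unfolding j_def using that by (intro Max_ge[OF fin]) auto
  ultimately have j: "1 \<le> j" "j \<le> n" "a j = 0"
    using max[OF assms(2,3)] assms(1) by simp_all
  have "exps_le (\<lambda>\<beta>. 1 * \<beta> j) (dyson n a) (\<Sum>i\<le>n. \<Sum>k\<in>{i<..n}. if k = j then - 1 else 0)"
  proof (rule exps_le_dyson[OF additive_functional_eval])
    fix i k assume ik: "i < k" "k \<le> n"
    show "exps_le (\<lambda>\<beta>. 1 * \<beta> j)
        (ser_mult (qpoch_ser 1 i k (int (a i))) (qpoch_ser qq k i (int (a k) - 1)))
        (if k = j then - 1 else 0)"
    proof (cases "a k = 0")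
      case True
      then have "exps_le (\<lambda>\<beta>. 1 * \<beta> j)
        (ser_mult (qpoch_ser 1 i k (int (a i))) (qpoch_ser qq k i (int (a k) - 1)))
        (int (a i) * max 0 (1 * evec i k j) + 1 * evec i k j)"
      proof (intro exps_le_mult additive_functional_eval exps_le_qpoch)
        have "1 * evec i k j \<le> 0" using max[of k] True ik by (auto simp: evec_def)
        from exps_le_inverse_factor[where \<phi> = "\<lambda>\<beta>. 1 * \<beta> j", OF additive_functional_eval this ik(1)] True
        show "exps_le (\<lambda>\<beta>. 1 * \<beta> j) (qpoch_ser qq k i (int (a k) - 1)) (1 * evec i k j)"
          by simp
      qed
      moreover have "k \<le> j" using max[OF ik(2) True] .
      ultimately show ?thesis
        using ik by (elim exps_le_mono) (auto simp: evec_def)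
    next
      case False
      then have "1 \<le> a k" by simp
      from exps_le_dyson_factor[where a = a and j = k and i = i and \<phi> = "\<lambda>\<beta>. 1 * \<beta> j",
          OF additive_functional_eval this] False j ik
      show ?thesis
        by (elim exps_le_mono) (auto simp: evec_def)
    qed
  qed
  also have "(\<Sum>i\<le>n. \<Sum>k\<in>{i<..n}. if k = j then - 1 else 0) = (\<Sum>i\<le>n. if i < j then - 1 else 0 :: int)"
    using j by (intro sum.cong) auto
  also have "\<dots> = - int j"
  proof -
    have "{i. i \<le> n \<and> i < j} = {..<j}" using j by auto
    then show ?thesis by (simp add: sum.If_cases Int_def)
  qed
  finally have "\<beta> j \<le> - int j" if "\<beta> \<in> supp (dyson n a)" for \<beta>
    using that by (simp add: exps_le_def)
  moreover have "\<not> - pref_exp Q1 j \<le> - int j"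
    using pref_exp_less[OF j(1)] by simp
  ultimately have "(\<lambda>k. - pref_exp Q1 k) \<notin> supp (dyson n a)" by blast
  then show ?thesis by (simp add: ct_def ser_mult_monom not_in_suppD)
qed

end

subsection \<open>Packings of intervals\<close>

text \<open>If \<open>a k = 0\<close> the interval is empty: it may share its left end with another
  interval but not lie in its interior.\<close>

locale packing =
  fixes n :: nat and a \<alpha> :: "nat \<Rightarrow> nat"
  assumes disjoint: "\<And>i j. i \<le> n \<Longrightarrow> j \<le> n \<Longrightarrow> i \<noteq> j \<Longrightarrow> \<alpha> i + a i \<le> \<alpha> j \<or> \<alpha> j + a j \<le> \<alpha> i"
    and bounded: "\<And>k. k \<le> n \<Longrightarrow> \<alpha> k + a k \<le> (\<Sum>k\<le>n. a k)"
begin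

lemma card_tiles:
  assumes "F \<subseteq> {..n}"
  shows "card (\<Union>k\<in>F. {\<alpha> k..<\<alpha> k + a k}) = (\<Sum>k\<in>F. a k)"
proof -
  have "{\<alpha> i..<\<alpha> i + a i} \<inter> {\<alpha> j..<\<alpha> j + a j} = {}" if "i \<in> F" "j \<in> F" "i \<noteq> j" for i j
  proof -
    have "i \<le> n" "j \<le> n" using that assms by auto
    with disjoint[of i j] that(3) show ?thesis by force
  qed
  then have "card (\<Union>k\<in>F. {\<alpha> k..<\<alpha> k + a k}) = (\<Sum>k\<in>F. card {\<alpha> k..<\<alpha> k + a k})"
    using finite_subset[OF assms] by (intro card_UN_disjoint) auto
  then show ?thesis by simp
qed

text \<open>Disjoint intervals inside [0, |a|) with total length |a| leave no gap.\<close>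

lemma tiles_cover: "(\<Union>k\<le>n. {\<alpha> k..<\<alpha> k + a k}) = {..<\<Sum>k\<le>n. a k}"
proof (rule card_subset_eq)
  show "(\<Union>k\<le>n. {\<alpha> k..<\<alpha> k + a k}) \<subseteq> {..<\<Sum>k\<le>n. a k}"
  proof clarify
    fix p k assume "k \<le> n" "p \<in> {\<alpha> k..<\<alpha> k + a k}"
    with bounded[of k] show "p < (\<Sum>k\<le>n. a k)" by simp
  qed
qed (simp_all add: card_tiles)

text \<open>Describes how far the tiling has been reconstructed from the left.\<close>

definition initial :: "nat set \<Rightarrow> bool" where
  "initial F \<longleftrightarrow> F \<subseteq> {..n} \<and> (\<Union>k\<in>F. {\<alpha> k..<\<alpha> k + a k}) = {..<\<Sum>k\<in>F. a k}"

lemma initial_empty: "initial {}"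
  by (simp add: initial_def)

lemma initial_insert:
  assumes "initial F" "k \<le> n" "k \<notin> F" "\<alpha> k = (\<Sum>k\<in>F. a k)"
  shows "initial (insert k F)"
proof -
  have "finite F" using assms(1) by (auto simp: initial_def intro: finite_subset)
  moreover have "{\<alpha> k..<\<alpha> k + a k} \<union> {..<\<alpha> k} = {..<\<alpha> k + a k}" by auto
  ultimately show ?thesis using assms by (simp add: initial_def add.commute)
qed

text \<open>A nonempty interval cannot start where others already fill the line; the exception is an
  empty one that shares a left end, which later concerns vertex 0 with
  \<open>a 0 = 0\<close>.\<close>

lemma start_in_initial:
  assumes "initial F" "k \<le> n" "k \<notin> F" "\<alpha> k < (\<Sum>k\<in>F. a k)"
  shows "\<exists>j\<in>F. \<alpha> k = \<alpha> j \<and> a k = 0"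
proof -
  have "\<alpha> k \<in> (\<Union>k\<in>F. {\<alpha> k..<\<alpha> k + a k})" using assms by (simp add: initial_def)
  then obtain j where j: "j \<in> F" "\<alpha> j \<le> \<alpha> k" "\<alpha> k < \<alpha> j + a j" by auto
  with assms have "j \<le> n" "j \<noteq> k" by (auto simp: initial_def)
  with disjoint[of j k] j assms(2) show ?thesis by (intro bexI[of _ j]) auto
qed

text \<open>The first uncovered position lies in some interval, which by
  \<open>start_in_initial\<close> cannot begin earlier. As that interval is nonempty, an empty one
  is never chosen.\<close>

lemma next_tile:
  assumes F: "initial F" and less: "(\<Sum>k\<in>F. a k) < (\<Sum>k\<le>n. a k)"
  obtains k where "k \<le> n" "k \<notin> F" "0 < a k" "\<alpha> k = (\<Sum>k\<in>F. a k)"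
proof -
  let ?p = "\<Sum>k\<in>F. a k"
  have "?p \<in> (\<Union>k\<le>n. {\<alpha> k..<\<alpha> k + a k})" using less by (simp add: tiles_cover)
  then obtain k where k: "k \<le> n" "\<alpha> k \<le> ?p" "?p < \<alpha> k + a k" by auto
  have kF: "k \<notin> F"
  proof
    assume "k \<in> F"
    with k have "?p \<in> (\<Union>k\<in>F. {\<alpha> k..<\<alpha> k + a k})" by auto
    with F show False by (simp add: initial_def)
  qed
  moreover have "\<not> \<alpha> k < ?p"
    using start_in_initial[OF F k(1) kF] k by auto
  ultimately show thesis using that[of k] k by simp
qed

text \<open>At the end of the first t intervals the next one is not among those placed, and
  \<open>avoid\<close> bars all vertices outside \<open>l 0, ..., l t\<close>; only
  \<open>l t\<close> is left.\<close>

lemma forced_tiles: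
  fixes l :: "nat \<Rightarrow> nat"
  assumes l: "inj_on l {..<m}" "l ` {..<m} \<subseteq> {..n}" "\<And>t. t < m \<Longrightarrow> 0 < a (l t)"
    and avoid: "\<And>t k. t < m \<Longrightarrow> k \<le> n \<Longrightarrow> k \<notin> l ` {..t} \<Longrightarrow> \<alpha> k \<noteq> (\<Sum>s<t. a (l s))"
    and "t \<le> m"
  shows "initial (l ` {..<t}) \<and> (\<forall>s<t. \<alpha> (l s) = (\<Sum>r<s. a (l r)))"
  using \<open>t \<le> m\<close>
proof (induction t)
  case (Suc t)
  have inj: "inj_on l {..<t}" by (rule inj_on_subset[OF l(1)]) (use Suc.prems in auto)
  have lt: "l t \<notin> l ` {..<t}" 
    using inj_on_image_mem_iff[OF l(1), of t "{..<t}"] Suc.prems by auto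
  have ltn: "l t \<le> n" using l(2) Suc.prems by (simp add: image_subset_iff)
  have sum: "(\<Sum>k\<in>l ` {..<t}. a k) = (\<Sum>s<t. a (l s))" by (simp add: sum.reindex[OF inj])
  have sub: "insert (l t) (l ` {..<t}) \<subseteq> {..n}"
    using l(2) Suc.prems by (simp add: image_subset_iff)
  have "(\<Sum>k\<in>l ` {..<t}. a k) < (\<Sum>k\<in>insert (l t) (l ` {..<t}). a k)"
    using lt l(3)[of t] Suc.prems by simp
  also have "\<dots> \<le> (\<Sum>k\<le>n. a k)" by (rule sum_mono2[OF _ sub]) auto
  finally have "(\<Sum>k\<in>l ` {..<t}. a k) < (\<Sum>k\<le>n. a k)" .
  with Suc obtain k where k: "k \<le> n" "k \<notin> l ` {..<t}" "\<alpha> k = (\<Sum>k\<in>l ` {..<t}. a k)"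
    by (metis next_tile Suc_leD)
  with avoid[of t k] Suc.prems sum have "k \<in> l ` {..t}" by auto
  with k have kt: "k = l t" by (auto simp: le_less)
  have "initial (insert k (l ` {..<t}))"
    by (rule initial_insert) (use k Suc in auto)
  then have "initial (l ` {..<Suc t})" by (simp add: kt lessThan_Suc)
  moreover have "\<alpha> (l s) = (\<Sum>r<s. a (l r))" if "s < Suc t" for s
    using that Suc k sum kt by (auto simp: less_Suc_eq)
  ultimately show ?case by blast
qed (simp add: initial_empty)

end

text \<open>The zeros of the two q-factorials of a pair i < j lie at \<alpha>_j - \<alpha>_i in [0,
  a_i) and at \<alpha>_i - \<alpha>_j in [1, a_j). Only the first range can contain 0, so equal left
  ends are possible if \<open>a i = 0\<close>.\<close>

lemma packing_if_eval_nonzero: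
  assumes a_pos: "\<And>j. 1 \<le> j \<Longrightarrow> j \<le> n \<Longrightarrow> 1 \<le> a j"
    and "ser_eval n (\<lambda>k. qq ^ \<alpha> k) (dyson n a) \<noteq> 0"
    and "\<And>k. k \<le> n \<Longrightarrow> \<alpha> k + a k \<le> (\<Sum>k\<le>n. a k)"
  shows "packing n a \<alpha>"
proof
  have ordered: "\<alpha> i + a i \<le> \<alpha> j \<or> \<alpha> j + a j \<le> \<alpha> i" if "i < j" "j \<le> n" for i j
  proof -
    have nz: "(\<Prod>t<a i. 1 - qq ^ t * (qq ^ \<alpha> i / qq ^ \<alpha> j)) \<noteq> 0"
             "(\<Prod>t\<in>{1..<a j}. 1 - qq ^ t * (qq ^ \<alpha> j / qq ^ \<alpha> i)) \<noteq> 0"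
      using assms(2) that by (auto simp: ser_eval_dyson[of n a, OF a_pos] qq_nonzero)
    have 1: "\<alpha> j \<noteq> \<alpha> i + t" if "t < a i" for t
      using nz(1) that by (force simp: power_add qq_nonzero)
    have 2: "\<alpha> i \<noteq> \<alpha> j + t" if "1 \<le> t" "t < a j" for t
      using nz(2) that by (force simp: power_add qq_nonzero)
    from 1[of "\<alpha> j - \<alpha> i"] 2[of "\<alpha> i - \<alpha> j"] show ?thesis by linarith
  qed
  show "\<alpha> i + a i \<le> \<alpha> j \<or> \<alpha> j + a j \<le> \<alpha> i" if "i \<le> n" "j \<le> n" "i \<noteq> j" for i j
    using ordered[of i j] ordered[of j i] that by (cases i j rule: linorder_cases) auto
qed (rule assms(3))

text \<open>The n - k ones subtracted in the shift are the reason why the size of a removal set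
  starts from n - k.\<close>

lemma dyson_shift_eq:
  assumes a_pos: "\<And>j. 1 \<le> j \<Longrightarrow> j \<le> n \<Longrightarrow> 1 \<le> a j" and "k \<le> n"
  shows "dyson_shift n a k + (n - k) + a k = (\<Sum>k\<le>n. a k)"
proof -
  have "(\<Sum>j\<in>{k<..n}. a j - 1) + (n - k) = (\<Sum>j\<in>{k<..n}. a j - 1 + 1)"
    by (simp add: sum.distrib del: add_Suc_right)
  also have "\<dots> = (\<Sum>j\<in>{k<..n}. a j)"
  proof (rule sum.cong)
    fix j assume "j \<in> {k<..n}"
    with a_pos[of j] show "a j - 1 + 1 = a j" by simp
  qed simp
  finally have "dyson_shift n a k + (n - k) + a k = (\<Sum>i<k. a i) + a k + (\<Sum>j\<in>{k<..n}. a j)"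
    by (simp add: dyson_shift_def)
  also have "\<dots> = (\<Sum>i\<in>{..k} \<union> {k<..n}. a i)"
    by (subst sum.union_disjoint) (auto simp: lessThan_Suc_atMost[symmetric])
  also have "{..k} \<union> {k<..n} = {..n}" using assms(2) by auto
  finally show ?thesis .
qed

subsection \<open>Tournaments\<close>

text \<open>Vertex 1 is left out: it beats all others, so it is nobody's out-neighbour.\<close>

definition out_nbrs :: "nat \<Rightarrow> (nat \<times> nat) set \<Rightarrow> nat \<Rightarrow> nat set" where
  "out_nbrs n Q1 k = {j\<in>{2..n}. beats Q1 k j}"

text \<open>In each case the value is n - k + e_k with e_k the exponent of x_k in the prefactor: e_0
  = 1, e_1 = -1, and \<open>pref_exp_outdegree\<close> otherwise.\<close>

definition removal_size :: "nat \<Rightarrow> (nat \<times> nat) set \<Rightarrow> nat \<Rightarrow> nat" where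
  "removal_size n Q1 k = (if k = 0 then n + 1 else if k = 1 then n - 2 else card (out_nbrs n Q1 k))"

locale dyson_tournament =
  fixes n :: nat and a :: "nat \<Rightarrow> nat" and Q1 :: "(nat \<times> nat) set"
  assumes n2: "2 \<le> n" and Q1: "Q1 \<subseteq> {(i, j). 2 \<le> i \<and> i < j \<and> j \<le> n}"
    and a_pos: "\<And>j. 1 \<le> j \<Longrightarrow> j \<le> n \<Longrightarrow> 1 \<le> a j"
begin

abbreviation total :: nat where "total \<equiv> \<Sum>k\<le>n. a k"

lemma sum_le_total: "F \<subseteq> {..n} \<Longrightarrow> (\<Sum>k\<in>F. a k) \<le> total"
  by (rule sum_mono2) auto

lemma a_le_total: "k \<le> n \<Longrightarrow> a k \<le> total"
  using sum_le_total[of "{k}"] by simp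

lemma beats_irrefl: "\<not> beats Q1 i i"
  by (simp add: beats_def)

lemma beats_total: "i \<noteq> j \<Longrightarrow> beats Q1 i j \<or> beats Q1 j i"
  by (auto simp: beats_def)

lemma beats_asym: "beats Q1 i j \<Longrightarrow> \<not> beats Q1 j i"
  by (auto simp: beats_def)

lemma not_beats_1: "1 \<le> i \<Longrightarrow> \<not> beats Q1 i 1"
  using Q1 by (auto simp: beats_def)

lemma card_grid_set:
  assumes R: "\<And>k. k \<le> n \<Longrightarrow> R k \<subseteq> {..total - a k}" "\<And>k. k \<le> n \<Longrightarrow> card (R k) = removal_size n Q1 k"
    and k: "k \<le> n"
  shows "int (card ({..total - a k} - R k)) = int (dyson_shift n a k) - pref_exp Q1 k + 1"
proof -
  have sz: "int (removal_size n Q1 k) = int n - int k + pref_exp Q1 k"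
  proof -
    consider "k = 0" | "k = 1" | "2 \<le> k" by linarith
    then show ?thesis
      using pref_exp_le_1[OF n2 Q1] pref_exp_outdegree[OF n2 Q1 _ k] n2
      by cases (auto simp: removal_size_def out_nbrs_def)
  qed
  have "finite (R k)" by (rule finite_subset[OF R(1)[OF k]]) simp
  then have "card ({..total - a k} - R k) = total - a k + 1 - card (R k)"
    by (subst card_Diff_subset) (use R(1)[OF k] in auto)
  moreover have "card (R k) \<le> card {..total - a k}"
    by (rule card_mono) (use R(1)[OF k] in auto)
  ultimately show ?thesis
    using sz R(2)[OF k] dyson_shift_eq[of n a k, OF a_pos k] k
    unfolding card_atMost by linarith
qed

lemma ct_removal:
  assumes R: "\<And>k. k \<le> n \<Longrightarrow> R k \<subseteq> {..total - a k}" "\<And>k. k \<le> n \<Longrightarrow> card (R k) = removal_size n Q1 k"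
  shows "ct (ser_mult (ser_monom (pref_exp Q1)) (dyson n a)) =
    (\<Sum>\<alpha>\<in>PiE {..n} (\<lambda>k. {..total - a k} - R k). ser_eval n (\<lambda>k. qq ^ \<alpha> k) (dyson n a) *
       (\<Prod>k\<le>n. (qq ^ \<alpha> k) ^ dyson_shift n a k / grid_weight ({..total - a k} - R k) (\<alpha> k)))"
proof (rule ct_dyson_grid[of n a, OF a_pos])
  show "(\<Sum>k\<le>n. pref_exp Q1 k) = 0" by (rule sum_pref_exp[OF n2 Q1])
  show "pref_exp Q1 k = 0" if "n < k" for k by (rule pref_exp_outside[OF n2 Q1 that])
  show "int (card ({..total - a k} - R k)) = int (dyson_shift n a k) - pref_exp Q1 k + 1"
    if "k \<le> n" for k
    by (rule card_grid_set[OF R that])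
qed simp_all

lemma packing_grid_point:
  assumes "\<alpha> \<in> PiE {..n} (\<lambda>k. {..total - a k} - R k)"
    and "ser_eval n (\<lambda>k. qq ^ \<alpha> k) (dyson n a) \<noteq> 0"
  shows "packing n a \<alpha>"
proof (rule packing_if_eval_nonzero[of n a, OF a_pos assms(2)])
  fix k assume "k \<le> n"
  with assms(1) have "\<alpha> k \<le> total - a k" by auto
  with a_le_total[OF \<open>k \<le> n\<close>] show "\<alpha> k + a k \<le> total" by simp
qed

text \<open>Leaves room to pad a set of prescribed removals to its exact size; the reason is that
  every other vertex of {1..n} has an interval of length at least 1.\<close>

lemma removal_size_le:
  assumes "k \<le> n"
  shows "removal_size n Q1 k \<le> total - a k + 1"
proof -
  have "1 \<le> a j" if "j \<in> {1..n} - {k}" for j using that a_pos[of j] by simp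
  then have "(\<Sum>j\<in>{1..n} - {k}. 1) \<le> (\<Sum>j\<in>{1..n} - {k}. a j)" by (rule sum_mono)
  then have "card ({1..n} - {k}) \<le> (\<Sum>j\<in>{1..n} - {k}. a j)" unfolding card_eq_sum .
  moreover have "(\<Sum>j\<in>{1..n} - {k}. a j) + a k \<le> total"
    using sum_le_total[of "insert k ({1..n} - {k})"] assms by (simp del: insert_Diff_single add: subset_iff)
  moreover have "card ({1..n} - {k}) = n - (if k = 0 then 0 else 1)"
    using assms by (cases "k = 0") auto
  ultimately have le: "n - (if k = 0 then 0 else 1) + a k \<le> total" by linarith
  have out: "card (out_nbrs n Q1 k) \<le> n - 2" if "2 \<le> k"
  proof -
    have "card (out_nbrs n Q1 k) \<le> card ({2..n} - {k})"
      by (intro card_mono) (auto simp: out_nbrs_def beats_irrefl)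
    with that assms show ?thesis by simp
  qed
  consider "k = 0" | "k = 1" | "2 \<le> k" by linarith
  then show ?thesis
    by cases (use le out in \<open>simp_all add: removal_size_def\<close>)
qed

text \<open>A chain lists vertices of \<open>{2..n}\<close>, losers first, each of which beats exactly the vertices
  listed before it. In a nonzero term of the grid sum, the intervals of a chain are packed from
  the left in the order of the chain.\<close>
definition chain :: "(nat \<Rightarrow> nat) \<Rightarrow> nat \<Rightarrow> bool" where
  "chain l m \<longleftrightarrow> l ` {..<m} \<subseteq> {2..n} \<and> (\<forall>t<m. out_nbrs n Q1 (l t) = l ` {..<t})"

lemma chain_mem: "chain l m \<Longrightarrow> t < m \<Longrightarrow> l t \<in> {2..n}"
  by (auto simp: chain_def image_subset_iff)

lemma chain_inj:
  assumes "chain l m"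
  shows "inj_on l {..<m}"
proof (rule linorder_inj_onI')
  fix s t assume st: "s \<in> {..<m}" "t \<in> {..<m}" "s < t"
  show "l s \<noteq> l t"
  proof
    assume "l s = l t"
    with st assms have "l t \<in> out_nbrs n Q1 (l t)" unfolding chain_def by (metis image_eqI lessThan_iff)
    then show False by (simp add: out_nbrs_def beats_irrefl)
  qed
qed

lemma chain_beaten:
  assumes "chain l m" "t < m" "k \<in> {2..n}" "k \<notin> l ` {..t}"
  shows "beats Q1 k (l t)"
proof (rule ccontr)
  assume "\<not> ?thesis"
  with beats_total[of k "l t"] assms have "beats Q1 (l t) k" by auto
  with assms have "k \<in> l ` {..<t}" unfolding chain_def out_nbrs_def by blast
  with assms(4) show False by auto
qed

text \<open>For \<open>t\<close> equal to the length of the chain this is where the interval after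
  the whole chain has to start.\<close>

definition chain_pos :: "(nat \<Rightarrow> nat) \<Rightarrow> nat \<Rightarrow> nat" where
  "chain_pos l t = (\<Sum>s<t. a (l s))"

lemma chain_pos_strict:
  assumes "chain l m" "s < t" "t \<le> m"
  shows "chain_pos l s < chain_pos l t"
proof -
  have "chain_pos l s < chain_pos l (Suc s)"
    using chain_mem[OF assms(1), of s] a_pos[of "l s"] assms(2,3) by (simp add: chain_pos_def)
  also have "\<dots> \<le> chain_pos l t"
    unfolding chain_pos_def using assms(2) by (intro sum_mono2) auto
  finally show ?thesis .
qed

lemma chain_pos_inj: "chain l m \<Longrightarrow> inj_on (chain_pos l) {..m}"
  by (rule linorder_inj_onI') (auto dest: chain_pos_strict[of l m])

lemma chain_pos_bound:
  assumes "chain l m" "t \<le> m" "k \<le> n" "k \<notin> l ` {..<t}"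
  shows "chain_pos l t + a k \<le> total"
proof -
  have "inj_on l {..<t}" by (rule inj_on_subset[OF chain_inj[OF assms(1)]]) (use assms in auto)
  then have "chain_pos l t + a k = (\<Sum>k\<in>insert k (l ` {..<t}). a k)"
    using assms(4) by (simp add: chain_pos_def sum.reindex)
  also have "\<dots> \<le> total"
    using assms by (intro sum_le_total) (auto simp: chain_def image_subset_iff)
  finally show ?thesis .
qed

lemma chain_forced:
  assumes "packing n a \<alpha>" and l: "chain l m"
    and avoid: "\<And>t k. t < m \<Longrightarrow> k \<le> n \<Longrightarrow> k \<notin> l ` {..t} \<Longrightarrow> \<alpha> k \<noteq> chain_pos l t"
  shows "packing.initial n a \<alpha> (l ` {..<m})" "\<And>s. s < m \<Longrightarrow> \<alpha> (l s) = chain_pos l s"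
proof -
  interpret packing n a \<alpha> by fact
  have "0 < a (l t)" "l t \<le> n" if "t < m" for t
    using chain_mem[OF l that] a_pos[of "l t"] by auto
  then have "initial (l ` {..<m}) \<and> (\<forall>s<m. \<alpha> (l s) = (\<Sum>r<s. a (l r)))"
    using avoid chain_inj[OF l] by (intro forced_tiles[of l m]) (auto simp: chain_pos_def)
  then show "initial (l ` {..<m})" "\<And>s. s < m \<Longrightarrow> \<alpha> (l s) = chain_pos l s"
    by (auto simp: chain_pos_def)
qed

text \<open>A longest chain exists since its vertices are distinct. A vertex of {2..n} off the chain
  beats all of it by \<open>chain_beaten\<close>; if it beat nothing else it could be appended, so
  its out-degree is larger than \<open>m\<close>.\<close>

lemma maximal_chain:
  obtains l m where "chain l m" "\<And>k. k \<in> {2..n} \<Longrightarrow> k \<notin> l ` {..<m} \<Longrightarrow> m < card (out_nbrs n Q1 k)"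
proof -
  have bound: "m \<le> n" if "\<exists>l. chain l m" for m
  proof -
    from that obtain l where l: "chain l m" by blast
    have "card {..<m} \<le> card {2..n}"
      by (rule card_inj_on_le[OF chain_inj[OF l]]) (use l in \<open>auto simp: chain_def\<close>)
    then show ?thesis by simp
  qed
  define m where "m = (GREATEST m. \<exists>l. chain l m)"
  have "\<exists>l. chain l m"
    unfolding m_def
    by (rule GreatestI_nat[of "\<lambda>m. \<exists>l. chain l m" 0, OF _ bound]) (auto simp: chain_def)
  then obtain l where l: "chain l m" by blast
  have max: "\<not> chain l' (Suc m)" for l'
    using Greatest_le_nat[of "\<lambda>m. \<exists>l. chain l m" "Suc m", OF _ bound] by (auto simp: m_def)
  have "m < card (out_nbrs n Q1 k)" if k: "k \<in> {2..n}" "k \<notin> l ` {..<m}" for k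
  proof -
    have sub: "l ` {..<m} \<subseteq> out_nbrs n Q1 k"
    proof clarify
      fix t assume "t < m"
      with k(2) have "k \<notin> l ` {..t}" by auto
      from chain_beaten[OF l \<open>t < m\<close> k(1) this] chain_mem[OF l \<open>t < m\<close>]
      show "l t \<in> out_nbrs n Q1 k" by (auto simp: out_nbrs_def)
    qed
    moreover have "l ` {..<m} \<noteq> out_nbrs n Q1 k"
    proof
      assume eq: "l ` {..<m} = out_nbrs n Q1 k"
      have im: "(l(m := k)) ` {..<t} = l ` {..<t}" if "t \<le> m" for t
        using that by (intro image_cong) auto
      have "(l(m := k)) ` {..<Suc m} = insert k (l ` {..<m})"
        using im[of m] unfolding lessThan_Suc image_insert by simp
      moreover have "out_nbrs n Q1 ((l(m := k)) t) = (l(m := k)) ` {..<t}" if "t < Suc m" for t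
        using that im[of t] eq l by (cases "t = m") (simp_all add: chain_def)
      ultimately have "chain (l(m := k)) (Suc m)"
        using l k(1) unfolding chain_def by simp
      with max show False by blast
    qed
    ultimately have "card (l ` {..<m}) < card (out_nbrs n Q1 k)"
      by (intro psubset_card_mono) (auto simp: out_nbrs_def)
    then show ?thesis using chain_inj[OF l] by (simp add: card_image)
  qed
  with l that show thesis by blast
qed

text \<open>All vertices off a maximal chain get the m + 1 positions
  \<open>chain_pos l 0, ..., chain_pos l m\<close> removed, which their removal sizes permit; then
  the chain is packed and nothing can start at its end.\<close>

lemma ct_nontransitive:
  assumes "\<not> tour_transitive n Q1"
  shows "ct (ser_mult (ser_monom (pref_exp Q1)) (dyson n a)) = 0"
proof -
  obtain l m where l: "chain l m"
    and max: "\<And>k. k \<in> {2..n} \<Longrightarrow> k \<notin> l ` {..<m} \<Longrightarrow> m < card (out_nbrs n Q1 k)"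
    by (rule maximal_chain) blast
  obtain x y z where xyz: "x \<in> {1..n}" "y \<in> {1..n}" "z \<in> {1..n}"
    "beats Q1 x y" "beats Q1 y z" "beats Q1 z x"
    using assms by (auto simp: tour_transitive_def)
  have "x \<noteq> 1" "y \<noteq> 1" "z \<noteq> 1"
    using not_beats_1[of x] not_beats_1[of y] not_beats_1[of z] xyz by auto
  with xyz have ge2: "{x, y, z} \<subseteq> {2..n}" by auto
  have distinct: "x \<noteq> y" "y \<noteq> z" "z \<noteq> x"
    using xyz(4-6) by (auto simp: beats_irrefl)
  \<comment> \<open>The first vertex of the cycle on the chain would beat its successor in the
    cycle, which would then be listed even earlier.\<close>
  have notin: "l t \<notin> {x, y, z}" if "t < m" for t
    using that
  proof (induction t rule: less_induct)
    case (less t)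
    have "k \<notin> out_nbrs n Q1 (l t)" if "k \<in> {x, y, z}" for k
    proof
      assume "k \<in> out_nbrs n Q1 (l t)"
      with l less.prems obtain s where "s < t" "k = l s" by (auto simp: chain_def)
      with less.IH[of s] less.prems that show False by auto
    qed
    from this[of x] this[of y] this[of z] ge2 xyz(4-6) show ?case by (auto simp: out_nbrs_def)
  qed
  \<comment> \<open>Chain and cycle are disjoint in {2..n}. The bound matters for vertex 1, where m
    + 1 of the n - 2 removals are prescribed.\<close>
  have "m + 4 \<le> n"
  proof -
    have "l ` {..<m} \<union> {x, y, z} \<subseteq> {2..n}" using l ge2 by (auto simp: chain_def)
    then have "card (l ` {..<m} \<union> {x, y, z}) \<le> n - 1" 
      using card_mono[of "{2..n}" "l ` {..<m} \<union> {x, y, z}"] by simp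
    moreover have "card (l ` {..<m} \<union> {x, y, z}) = m + 3"
      using notin distinct chain_inj[OF l] by (subst card_Un_disjoint) (auto simp: card_image)
    ultimately show ?thesis by simp
  qed
  have "\<exists>R. R \<subseteq> {..total - a k} \<and> card R = removal_size n Q1 k \<and>
      (\<forall>t<m. k \<notin> l ` {..t} \<longrightarrow> chain_pos l t \<in> R) \<and> (k \<notin> l ` {..<m} \<longrightarrow> chain_pos l m \<in> R)"
    if k: "k \<le> n" for k
  proof (cases "k \<in> l ` {..<m}")
    case True
    then obtain t where t: "t < m" "k = l t" by auto
    have k2: "2 \<le> k" using chain_mem[OF l t(1)] t(2) by simp
    have notin: "k \<notin> l ` {..<s}" if "s \<le> t" for s
      using inj_on_image_mem_iff[OF chain_inj[OF l], of t "{..<s}"] t that by auto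
    \<comment> \<open>The out-degree of \<open>l t\<close> is t, so exactly the t earlier positions
      are removed, with none to spare.\<close>
    let ?R = "chain_pos l ` {..<t}"
    have "?R \<subseteq> {..total - a k}"
    proof (rule image_subsetI)
      fix s assume "s \<in> {..<t}"
      with chain_pos_bound[OF l _ k notin[of s]] t
      show "chain_pos l s \<in> {..total - a k}" by simp
    qed
    moreover have "inj_on (chain_pos l) {..<t}" "inj_on l {..<t}"
      using inj_on_subset[OF chain_pos_inj[OF l], of "{..<t}"]
        inj_on_subset[OF chain_inj[OF l], of "{..<t}"] t(1) by (simp_all add: subset_iff)
    then have "card ?R = removal_size n Q1 k"
      using k2 l t by (simp add: removal_size_def chain_def card_image)
    moreover have "chain_pos l s \<in> ?R" if "s < m" "k \<notin> l ` {..s}" for s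
      using that t by (cases "s < t") auto
    ultimately show ?thesis using True by blast
  next
    case False
    have bound: "chain_pos l t + a k \<le> total" if "t \<le> m" for t
      using False that by (intro chain_pos_bound[OF l that k]) auto
    have sub: "chain_pos l ` {..m} \<subseteq> {..total - a k}"
      using bound by fastforce
    have "card (chain_pos l ` {..m}) = m + 1"
      using chain_pos_inj[OF l] by (simp add: card_image)
    also have "\<dots> \<le> removal_size n Q1 k"
      using max[of k] False k \<open>m + 4 \<le> n\<close> by (auto simp: removal_size_def)
    finally have lower: "card (chain_pos l ` {..m}) \<le> removal_size n Q1 k" .
    have upper: "removal_size n Q1 k \<le> card {..total - a k}"
      using removal_size_le[OF k] by simp
    obtain R where "chain_pos l ` {..m} \<subseteq> R" "R \<subseteq> {..total - a k}" "card R = removal_size n Q1 k"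
      using exists_subset_between[OF lower upper sub] by auto
    then show ?thesis by (intro exI[of _ R]) auto
  qed
  then obtain R where R: "\<And>k. k \<le> n \<Longrightarrow> R k \<subseteq> {..total - a k}"
      "\<And>k. k \<le> n \<Longrightarrow> card (R k) = removal_size n Q1 k"
      "\<And>k t. k \<le> n \<Longrightarrow> t < m \<Longrightarrow> k \<notin> l ` {..t} \<Longrightarrow> chain_pos l t \<in> R k"
      "\<And>k. k \<le> n \<Longrightarrow> k \<notin> l ` {..<m} \<Longrightarrow> chain_pos l m \<in> R k"
    by metis
  have "ser_eval n (\<lambda>k. qq ^ \<alpha> k) (dyson n a) = 0"
    if \<alpha>: "\<alpha> \<in> PiE {..n} (\<lambda>k. {..total - a k} - R k)" for \<alpha>
  proof (rule ccontr)
    assume "\<not> ?thesis"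
    with \<alpha> interpret packing n a \<alpha> by (rule packing_grid_point)
    have notin: "\<alpha> k \<notin> R k" if "k \<le> n" for k using \<alpha> that by auto
    have init: "initial (l ` {..<m})"
      by (rule chain_forced[OF packing_axioms l]) (use R(3) notin in metis)
    have sum: "(\<Sum>k\<in>l ` {..<m}. a k) = chain_pos l m"
      by (simp add: chain_pos_def sum.reindex[OF chain_inj[OF l]])
    \<comment> \<open>Vertex 1 is not in the chain and has a nonempty interval, so the chain cannot
      fill everything.\<close>
    have "1 \<notin> l ` {..<m}" using l by (auto simp: chain_def)
    then have "chain_pos l m < total"
      using chain_pos_bound[OF l order_refl, of 1] a_pos[of 1] n2 by simp
    with init sum obtain k where "k \<le> n" "k \<notin> l ` {..<m}" "\<alpha> k = chain_pos l m"
      by (metis next_tile)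
    with R(4) notin show False by metis
  qed
  then show ?thesis by (subst ct_removal[OF R(1,2)]) auto
qed

end

subsection \<open>The transitive case\<close>

locale transitive_dyson_tournament = dyson_tournament +
  fixes \<sigma> :: "nat \<Rightarrow> nat"
  assumes transitive: "tour_transitive n Q1" and winner: "winner_perm n Q1 \<sigma>"
begin

lemma \<sigma>_permutes: "\<sigma> permutes {1..n}"
  using winner by (simp add: winner_perm_def)

lemma \<sigma>_eq_iff [simp]: "\<sigma> i = \<sigma> j \<longleftrightarrow> i = j"
  using permutes_inj[OF \<sigma>_permutes] by (simp add: inj_eq)

lemma \<sigma>_in_iff: "\<sigma> i \<in> {1..n} \<longleftrightarrow> i \<in> {1..n}"
  by (rule permutes_in_image[OF \<sigma>_permutes])

lemma \<sigma>_image: "\<sigma> ` {1..n} = {1..n}"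
  by (rule permutes_image[OF \<sigma>_permutes])

lemma \<sigma>_inj_on: "inj_on \<sigma> A"
  by (simp add: inj_on_def)

lemma \<sigma>_beats: "1 \<le> i \<Longrightarrow> i < j \<Longrightarrow> j \<le> n \<Longrightarrow> beats Q1 (\<sigma> i) (\<sigma> j)"
proof (induction j)
  case (Suc j)
  have step: "beats Q1 (\<sigma> k) (\<sigma> (Suc k))" if "1 \<le> k" "k < n" for k
    using winner that by (auto simp: winner_perm_def)
  show ?case
  proof (cases "i = j")
    case False
    with Suc have "beats Q1 (\<sigma> i) (\<sigma> j)" "beats Q1 (\<sigma> j) (\<sigma> (Suc j))" using step by auto
    moreover have "\<sigma> i \<in> {1..n}" "\<sigma> j \<in> {1..n}" "\<sigma> (Suc j) \<in> {1..n}"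
      unfolding \<sigma>_in_iff using Suc.prems by auto
    ultimately have "\<not> beats Q1 (\<sigma> (Suc j)) (\<sigma> i)"
      using transitive unfolding tour_transitive_def by blast
    with beats_total[of "\<sigma> i" "\<sigma> (Suc j)"] Suc.prems show ?thesis by auto
  qed (use step Suc.prems in auto)
qed simp

lemma \<sigma>_1: "\<sigma> 1 = 1"
proof -
  have "1 \<in> \<sigma> ` {1..n}" using n2 by (simp add: \<sigma>_image del: One_nat_def)
  then obtain i where i: "i \<in> {1..n}" "\<sigma> i = 1" by (metis imageE)
  have "1 \<le> \<sigma> 1" using \<sigma>_in_iff[of 1] n2 by simp
  have "\<not> 1 < i"
    using \<sigma>_beats[of 1 i] i not_beats_1[OF \<open>1 \<le> \<sigma> 1\<close>] by auto
  with i show ?thesis by (cases "i = 1") auto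
qed

lemma \<sigma>_image_2: "\<sigma> ` {2..n} = {2..n}"
proof -
  have "\<sigma> ` ({1..n} - {1}) = {1..n} - {1}"
    using image_set_diff[OF permutes_inj[OF \<sigma>_permutes], of "{1..n}" "{1}"]
    by (simp add: \<sigma>_image \<sigma>_1 del: One_nat_def)
  moreover have "{1..n} - {1} = {2..n}" by auto
  ultimately show ?thesis by simp
qed

lemma \<sigma>_ge_2: "2 \<le> i \<Longrightarrow> i \<le> n \<Longrightarrow> \<sigma> i \<in> {2..n}"
  using \<sigma>_image_2 by (metis atLeastAtMost_iff image_eqI)

lemma \<sigma>_cases:
  assumes "1 \<le> k" "k \<le> n"
  obtains i where "1 \<le> i" "i \<le> n" "k = \<sigma> i"
proof -
  have "k \<in> \<sigma> ` {1..n}" using assms \<sigma>_image by simp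
  with that show thesis by auto
qed

lemma a_\<sigma>_pos: "1 \<le> i \<Longrightarrow> i \<le> n \<Longrightarrow> 0 < a (\<sigma> i)"
  using a_pos[of "\<sigma> i"] \<sigma>_in_iff[of i] by simp

lemma out_nbrs_\<sigma>:
  assumes "2 \<le> i" "i \<le> n"
  shows "out_nbrs n Q1 (\<sigma> i) = \<sigma> ` {i<..n}"
proof -
  have "beats Q1 (\<sigma> i) (\<sigma> j) \<longleftrightarrow> i < j" if "j \<in> {2..n}" for j
    using \<sigma>_beats[of i j] \<sigma>_beats[of j i] beats_asym[of "\<sigma> i" "\<sigma> j"] beats_irrefl[of "\<sigma> i"] assms that
    by (cases i j rule: linorder_cases) auto
  then have "{j \<in> \<sigma> ` {2..n}. beats Q1 (\<sigma> i) j} = \<sigma> ` {i<..n}"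
    using assms by auto
  then show ?thesis by (simp add: out_nbrs_def \<sigma>_image_2)
qed

text \<open>The left endpoint of the interval of \<open>\<sigma> i\<close> when \<open>\<sigma> n, \<sigma> (n - 1), \<dots>\<close> are packed from the left.\<close>
definition P :: "nat \<Rightarrow> nat" where
  "P i = (\<Sum>k\<in>{i<..n}. a (\<sigma> k))"

lemma P_step:
  assumes "1 \<le> i" "i \<le> n"
  shows "P (i - 1) = P i + a (\<sigma> i)"
proof -
  have "{i - 1<..n} = insert i {i<..n}" using assms by auto
  then show ?thesis by (simp add: P_def)
qed

lemma P_less: "i < j \<Longrightarrow> j \<le> n \<Longrightarrow> P j < P i"
proof -
  assume ij: "i < j" "j \<le> n"
  have "P j < P j + a (\<sigma> j)" using a_\<sigma>_pos[of j] ij by simp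
  also have "\<dots> = P (j - 1)" using P_step[of j] ij by simp
  also have "\<dots> \<le> P i" unfolding P_def using ij by (intro sum_mono2) auto
  finally show ?thesis .
qed

lemma P_mono: "i \<le> j \<Longrightarrow> j \<le> n \<Longrightarrow> P j \<le> P i"
  using P_less[of i j] by (cases "i = j") auto

lemma P_eq_iff: "i \<le> n \<Longrightarrow> j \<le> n \<Longrightarrow> P i = P j \<longleftrightarrow> i = j"
  using P_less[of i j] P_less[of j i] by (cases i j rule: linorder_cases) auto

lemma P_inj_on: "A \<subseteq> {..n} \<Longrightarrow> inj_on P A"
  by (auto simp: inj_on_def P_eq_iff subset_iff)

lemma P_1: "P 1 = P 2 + a (\<sigma> 2)"
  using P_step[of 2] n2 by simp

lemma P_0: "P 0 = P 2 + a (\<sigma> 2) + a 1"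
  using P_step[of 1] n2 P_1 \<sigma>_1 by simp

lemma total_P_0: "total = P 0 + a 0"
proof -
  have "{..n} = insert 0 {1..n}" by auto
  moreover have "P 0 = (\<Sum>k\<in>{1..n}. a k)"
    unfolding P_def using sum.reindex[OF \<sigma>_inj_on, of a "{1..n}"] \<sigma>_image
    by (simp add: atLeastSucAtMost_greaterThanAtMost)
  ultimately show ?thesis by simp
qed

text \<open>Vertex \<sigma> i may not start at the left end \<open>P j\<close> of a vertex ranked
  below it. For i = 1 only n - 2 removals are available, hence \<open>max 2\<close>: both \<sigma> 1
  and \<sigma> 2 may start at \<open>P 2\<close>. Vertex 0 is barred from all n + 1 values,
  including \<open>P 0\<close>, the last start that leaves room for it.\<close>

definition R :: "nat \<Rightarrow> nat set" where
  "R k = (if k = 0 then P ` {..n} else P ` {max 2 (inv \<sigma> k)<..n})"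

lemma R_0: "R 0 = P ` {..n}"
  by (simp add: R_def)

lemma R_\<sigma>: "1 \<le> i \<Longrightarrow> i \<le> n \<Longrightarrow> R (\<sigma> i) = P ` {max 2 i<..n}"
  using permutes_inj[OF \<sigma>_permutes] \<sigma>_in_iff[of i] by (simp add: R_def inv_f_f)

lemma R_1: "R 1 = P ` {2<..n}"
  using R_\<sigma>[of 1] n2 \<sigma>_1 by (simp add: numeral_2_eq_2)

lemma R_bounded:
  assumes "k \<le> n"
  shows "R k \<subseteq> {..total - a k}"
proof (cases "k = 0")
  case True
  have "P i \<le> P 0" if "i \<le> n" for i using P_mono[of 0 i] that by simp
  with True show ?thesis by (auto simp: R_0 total_P_0)
next
  case False
  with assms obtain i where i: "1 \<le> i" "i \<le> n" "k = \<sigma> i" using \<sigma>_cases[of k] by auto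
  have "P j + a k \<le> total" if "max 2 i < j" "j \<le> n" for j
  proof -
    have "P j \<le> P i" using P_less[of i j] that by simp
    moreover have "P i + a k = P (i - 1)" using P_step[of i] i by simp
    moreover have "P (i - 1) \<le> P 0" using P_mono[of 0 "i - 1"] i by simp
    ultimately show ?thesis by (simp add: total_P_0)
  qed
  with i show ?thesis by (fastforce simp: R_\<sigma>)
qed

lemma card_R:
  assumes "k \<le> n"
  shows "card (R k) = removal_size n Q1 k"
proof (cases "k = 0")
  case True
  then show ?thesis by (simp add: R_0 removal_size_def card_image P_inj_on)
next
  case False
  with assms obtain i where i: "1 \<le> i" "i \<le> n" "k = \<sigma> i" using \<sigma>_cases[of k] by auto
  have c: "card (R k) = n - max 2 i"
    using i by (simp add: R_\<sigma> card_image P_inj_on subset_iff)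
  show ?thesis
  proof (cases "i = 1")
    case True
    with c i \<sigma>_1 show ?thesis by (simp add: removal_size_def)
  next
    case False
    with i have "2 \<le> i" by simp
    with \<sigma>_ge_2[of i] i have "2 \<le> k" by simp
    with c i out_nbrs_\<sigma>[of i] \<open>2 \<le> i\<close> show ?thesis
      by (simp add: removal_size_def card_image \<sigma>_inj_on)
  qed
qed

abbreviation A :: "nat \<Rightarrow> nat set" where "A k \<equiv> {..total - a k} - R k"

text \<open>Restricted to \<open>{..n}\<close> because the points of \<open>PiE\<close> are
  extensional.\<close>

definition \<pi> :: "nat \<Rightarrow> nat" where
  "\<pi> = (\<lambda>k\<in>{..n}. if k = 0 then P 2 + a 1 else if k = 1 then P 2
          else if k = \<sigma> 2 then P 2 + a 1 + a 0 else P (inv \<sigma> k))"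

lemma \<pi>_0: "\<pi> 0 = P 2 + a 1"
  by (simp add: \<pi>_def)

lemma \<pi>_1: "\<pi> 1 = P 2"
  using n2 by (simp add: \<pi>_def)

lemma \<pi>_\<sigma>2: "\<pi> (\<sigma> 2) = P 2 + a 1 + a 0"
  using n2 \<sigma>_ge_2[of 2] by (simp add: \<pi>_def)

lemma \<pi>_\<sigma>: "3 \<le> i \<Longrightarrow> i \<le> n \<Longrightarrow> \<pi> (\<sigma> i) = P i"
  using \<sigma>_ge_2[of i] permutes_inj[OF \<sigma>_permutes] by (simp add: \<pi>_def inv_f_f)

lemma vertex_cases:
  assumes "k \<le> n"
  obtains "k = 0" | "k = 1" | "k = \<sigma> 2" | i where "3 \<le> i" "i \<le> n" "k = \<sigma> i"
proof (cases "k = 0")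
  case False
  with assms obtain i where "1 \<le> i" "i \<le> n" "k = \<sigma> i" using \<sigma>_cases[of k] by auto
  then show thesis using that \<sigma>_1 by (cases "i = 1"; cases "i = 2") auto
qed (use that in simp)

text \<open>The hypothesis keeps vertex 0 off \<open>P 1 = P 2 + a (\<sigma> 2)\<close>. The other
  values forbidden to it are \<open>P 0\<close>, which is larger, and values of at most
  \<open>P 2\<close>.\<close>

lemma \<pi>_in_grid:
  assumes "a 1 \<noteq> a (\<sigma> 2)"
  shows "\<pi> \<in> PiE {..n} A"
proof (rule PiE_I)
  fix k assume "k \<in> {..n}"
  then have "k \<le> n" by simp
  have tot: "total = P 2 + a (\<sigma> 2) + a 1 + a 0" by (simp add: total_P_0 P_0)
  have pos: "0 < a 1" "0 < a (\<sigma> 2)" using a_pos[of 1] a_\<sigma>_pos[of 2] n2 by auto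
  from \<open>k \<le> n\<close> show "\<pi> k \<in> A k"
  proof (cases k rule: vertex_cases)
    case 1
    have "P i \<noteq> P 2 + a 1" if "i \<le> n" for i
    proof -
      consider "i = 0" | "i = 1" | "2 \<le> i" by linarith
      then show ?thesis
      proof cases
        case 3
        then have "P i \<le> P 2" using P_mono[of 2 i] that by simp
        with pos show ?thesis by simp
      qed (use pos assms P_0 P_1 in auto)
    qed
    then have "P 2 + a 1 \<notin> P ` {..n}" by force
    with 1 show ?thesis by (simp add: \<pi>_0 R_0 tot)
  next
    case 2
    have "P i < P 2" if "2 < i" "i \<le> n" for i using P_less[of 2 i] that by simp
    with 2 show ?thesis unfolding 2 \<pi>_1 R_1 by (force simp: tot)
  next
    case 3
    have "P i < P 2" if "2 < i" "i \<le> n" for i using P_less[of 2 i] that by simp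
    with 3 n2 show ?thesis unfolding 3 \<pi>_\<sigma>2 by (force simp: tot R_\<sigma>)
  next
    case (4 i)
    have "P i + a (\<sigma> i) = P (i - 1)" using P_step[of i] 4 by simp
    moreover have "P (i - 1) \<le> P 2" using P_mono[of 2 "i - 1"] 4 by simp
    moreover have "P j \<noteq> P i" if "i < j" "j \<le> n" for j using P_less[of i j] that by simp
    ultimately show ?thesis using 4 by (force simp: \<pi>_\<sigma> tot R_\<sigma>)
  qed
qed (simp add: \<pi>_def)

lemma \<sigma>_reversed_image:
  assumes "m \<le> n"
  shows "(\<lambda>t. \<sigma> (n - t)) ` {..<m} = \<sigma> ` {n - m<..n}"
proof -
  have "x \<in> (\<lambda>t. n - t) ` {..<m}" if "n - m < x" "x \<le> n" for x
    using that assms by (intro image_eqI[of _ _ "n - x"]) auto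
  then have "(\<lambda>t. n - t) ` {..<m} = {n - m<..n}"
    using assms by auto
  then show ?thesis by (metis image_image)
qed

lemma chain_\<sigma>: "chain (\<lambda>t. \<sigma> (n - t)) (n - 2)"
proof -
  have im: "(\<lambda>t. \<sigma> (n - t)) ` {..<m} = \<sigma> ` {n - m<..n}" if "m \<le> n" for m
    by (rule \<sigma>_reversed_image[OF that])
  show ?thesis
    unfolding chain_def
  proof (intro conjI allI impI)
    show "(\<lambda>t. \<sigma> (n - t)) ` {..<n - 2} \<subseteq> {2..n}"
      using \<sigma>_ge_2 by (force simp: image_subset_iff)
    show "out_nbrs n Q1 (\<sigma> (n - t)) = (\<lambda>t. \<sigma> (n - t)) ` {..<t}" if "t < n - 2" for t
      using that out_nbrs_\<sigma>[of "n - t"] im[of t] by simp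
  qed
qed

lemma chain_pos_\<sigma>:
  assumes "t \<le> n"
  shows "chain_pos (\<lambda>t. \<sigma> (n - t)) t = P (n - t)"
  unfolding chain_pos_def P_def using assms
  by (intro sum.reindex_bij_witness[where i = "\<lambda>k. n - k" and j = "\<lambda>s. n - s"]) auto

text \<open>After the forced part, vertex 0 cannot start at \<open>P 2\<close>. If \<sigma> 2 does,
  the next position is \<open>P 1\<close>, also barred to 0, so 1 follows and 0 is left without a
  place; hence 1 comes first.\<close>

lemma unique_point:
  assumes \<alpha>: "\<alpha> \<in> PiE {..n} A" and nz: "ser_eval n (\<lambda>k. qq ^ \<alpha> k) (dyson n a) \<noteq> 0"
  shows "\<alpha> = \<pi>" "a 1 \<noteq> a (\<sigma> 2)"
proof -
  interpret packing n a \<alpha> by (rule packing_grid_point[OF assms])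
  have notin: "\<alpha> k \<notin> R k" if "k \<le> n" for k using \<alpha> that by auto
  let ?F = "\<sigma> ` {2<..n}"
  define l where "l t = \<sigma> (n - t)" for t
  have l_image: "l ` {..<n - 2} = ?F"
    unfolding l_def using \<sigma>_reversed_image[of "n - 2"] n2 by simp
  have avoid: "\<alpha> k \<noteq> chain_pos l t" if "t < n - 2" "k \<le> n" "k \<notin> l ` {..t}" for t k
  proof -
    have pos: "chain_pos l t = P (n - t)" using chain_pos_\<sigma>[of t] that unfolding l_def by simp
    have "P (n - t) \<in> R k"
    proof (cases "k = 0")
      case False
      with that obtain i where i: "1 \<le> i" "i \<le> n" "k = \<sigma> i" using \<sigma>_cases[of k] by auto
      have "i < n - t"
      proof (rule ccontr)
        assume "\<not> ?thesis"
        with i have "k = l (n - i)" "n - i \<le> t" by (auto simp: l_def)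
        with that(3) show False by auto
      qed
      with i that show ?thesis by (auto simp: R_\<sigma>)
    qed (simp add: R_0)
    with notin[OF that(2)] pos show ?thesis by auto
  qed
  note forced = chain_forced[OF packing_axioms chain_\<sigma>[folded l_def] avoid]
  have F: "initial ?F" using forced(1) l_image by simp
  have \<alpha>_\<sigma>: "\<alpha> (\<sigma> i) = P i" if "3 \<le> i" "i \<le> n" for i
    using forced(2)[of "n - i"] chain_pos_\<sigma>[of "n - i", folded l_def] that by (simp add: l_def)
  have sumF: "(\<Sum>k\<in>?F. a k) = P 2" by (simp add: sum.reindex[OF \<sigma>_inj_on] P_def)
  have finF [simp]: "finite ?F" by simp
  have notF: "0 \<notin> ?F" "1 \<notin> ?F" "\<sigma> 2 \<notin> ?F"
  proof -
    have "?F \<subseteq> \<sigma> ` {2..n}" by auto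
    then have "?F \<subseteq> {2..n}" by (simp add: \<sigma>_image_2)
    then show "0 \<notin> ?F" "1 \<notin> ?F" by auto
    show "\<sigma> 2 \<notin> ?F" by auto
  qed
  have b: "2 \<le> \<sigma> 2" "\<sigma> 2 \<le> n" using \<sigma>_ge_2[of 2] n2 by auto
  have tot: "total = P 2 + a (\<sigma> 2) + a 1 + a 0" by (simp add: total_P_0 P_0)
  have pos: "0 < a 1" "0 < a (\<sigma> 2)" using a_pos[of 1] a_\<sigma>_pos[of 2] n2 by auto
  have rest: "k = 0 \<or> k = 1 \<or> k = \<sigma> 2" if "k \<le> n" "k \<notin> ?F" for k
    using that by (cases k rule: vertex_cases) auto
  have \<alpha>0: "\<alpha> 0 \<noteq> P i" if "i \<le> n" for i
    using notin[of 0] that by (auto simp: R_0)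
  \<comment> \<open>The range ends at \<open>P 0\<close>, and this value is itself removed.\<close>
  have \<alpha>0_less: "\<alpha> 0 < P 2 + a (\<sigma> 2) + a 1"
  proof -
    have "\<alpha> 0 \<le> total - a 0" using \<alpha> by auto
    then show ?thesis using \<alpha>0[of 0] by (simp add: tot P_0)
  qed
  have "\<alpha> 1 = P 2 \<and> \<alpha> 0 = P 2 + a 1 \<and> \<alpha> (\<sigma> 2) = P 2 + a 1 + a 0"
  proof -
    have "P 2 < total" using pos tot by simp
    then obtain k where k: "k \<le> n" "k \<notin> ?F" "\<alpha> k = P 2"
      using next_tile[OF F] sumF by metis
    have "k \<noteq> 0" using \<alpha>0[of 2] k n2 by auto
    with rest[OF k(1,2)] consider "k = 1" | "k = \<sigma> 2" by auto
    then show ?thesis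
    proof cases
      case 1
      let ?G = "insert 1 ?F"
      have G: "initial ?G" using k 1 notF sumF by (intro initial_insert F) auto
      have sumG: "(\<Sum>k\<in>?G. a k) = P 2 + a 1" using notF sumF by simp
      have "P 2 + a 1 < total" using pos tot by simp
      then obtain k' where k': "k' \<le> n" "k' \<notin> ?G" "\<alpha> k' = P 2 + a 1"
        using next_tile[OF G] sumG by metis
      with rest[of k'] consider "k' = 0" | "k' = \<sigma> 2" by auto
      then show ?thesis
      proof cases
        case 1
        let ?H = "insert 0 ?G"
        have H: "initial ?H" using k' 1 notF sumG by (intro initial_insert G) auto
        have sumH: "(\<Sum>k\<in>?H. a k) = P 2 + a 1 + a 0" using notF sumG by simp
        have "P 2 + a 1 + a 0 < total" using pos tot by simp
        then obtain k'' where "k'' \<le> n" "k'' \<notin> ?H" "\<alpha> k'' = P 2 + a 1 + a 0"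
          using next_tile[OF H] sumH by metis
        with rest[of k''] have "\<alpha> (\<sigma> 2) = P 2 + a 1 + a 0" by auto
        with k k' 1 \<open>k = 1\<close> show ?thesis by simp
      next
        case 2
        let ?H = "insert (\<sigma> 2) ?G"
        have H: "initial ?H" using k' 2 b notF sumG by (intro initial_insert G) auto
        have "(\<Sum>k\<in>?H. a k) = P 2 + a (\<sigma> 2) + a 1" using notF b sumG by simp
        \<comment> \<open>Vertex 0 now starts inside the filled part, so \<open>a 0 = 0\<close> and
          it shares a left end, which can only be that of \<sigma> 2. As \<open>a 0 = 0\<close>,
          these are the values claimed.\<close>
        with start_in_initial[OF H, of 0] \<alpha>0_less notF b
        obtain j where j: "j \<in> ?H" "\<alpha> 0 = \<alpha> j" "a 0 = 0" by auto
        have "j \<noteq> 1" using j \<alpha>0[of 2] k 1 n2 by auto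
        moreover have "j \<notin> ?F"
        proof
          assume "j \<in> ?F"
          then obtain i where "2 < i" "i \<le> n" "j = \<sigma> i" by auto
          with \<alpha>_\<sigma>[of i] \<alpha>0[of i] j(2) show False by simp
        qed
        ultimately have "j = \<sigma> 2" using j by simp
        with j k k' 1 2 show ?thesis by simp
      qed
    next
      case 2
      let ?G = "insert (\<sigma> 2) ?F"
      have G: "initial ?G" using k 2 b notF sumF by (intro initial_insert F) auto
      have sumG: "(\<Sum>k\<in>?G. a k) = P 1" using notF sumF P_1 by simp
      have "P 1 < total" using pos tot P_1 by simp
      then obtain k' where k': "k' \<le> n" "k' \<notin> ?G" "\<alpha> k' = P 1"
        using next_tile[OF G] sumG by metis
      moreover have "k' \<noteq> 0" using \<alpha>0[of 1] k' n2 by auto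
      ultimately have k'1: "k' = 1" using rest[of k'] by auto
      let ?H = "insert 1 ?G"
      have H: "initial ?H" using k' k'1 sumG by (intro initial_insert G) auto
      have "(\<Sum>k\<in>?H. a k) = P 2 + a (\<sigma> 2) + a 1" using notF k' k'1 sumG P_1 by simp
      \<comment> \<open>Vertex 0 would have to share one of the left ends of the filled part; these
        are all values of \<open>P\<close> and so removed for 0.\<close>
      with start_in_initial[OF H, of 0] \<alpha>0_less notF b
      obtain j where j: "j \<in> ?H" "\<alpha> 0 = \<alpha> j" by auto
      have "\<alpha> j \<in> P ` {..n}"
        using j(1) k k' k'1 2 n2 \<alpha>_\<sigma> by auto
      with j \<alpha>0 show ?thesis by auto
    qed
  qed
  note vals = this
  \<comment> \<open>Equal parameters would put vertex 0 on \<open>P 1\<close>, which is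
    removed.\<close>
  show "a 1 \<noteq> a (\<sigma> 2)" using vals \<alpha>0[of 1] P_1 n2 by auto
  show "\<alpha> = \<pi>"
  proof (rule extensionalityI)
    show "\<alpha> \<in> extensional {..n}" using \<alpha> by (simp add: PiE_def)
    show "\<pi> \<in> extensional {..n}" by (simp add: \<pi>_def)
    fix k assume "k \<in> {..n}"
    then have "k \<le> n" by simp
    then show "\<alpha> k = \<pi> k"
      using vals \<alpha>_\<sigma> \<pi>_0 \<pi>_1 \<pi>_\<sigma>2 \<pi>_\<sigma> by (cases k rule: vertex_cases) auto
  qed
qed

lemma ct_single_term:
  assumes "a 1 \<noteq> a (\<sigma> 2)"
  shows "ct (ser_mult (ser_monom (pref_exp Q1)) (dyson n a)) =
    ser_eval n (\<lambda>k. qq ^ \<pi> k) (dyson n a) *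
    (\<Prod>k\<le>n. (qq ^ \<pi> k) ^ dyson_shift n a k / grid_weight (A k) (\<pi> k))"
    (is "_ = ?t \<pi>")
proof -
  have "ct (ser_mult (ser_monom (pref_exp Q1)) (dyson n a)) = (\<Sum>\<alpha>\<in>PiE {..n} A. ?t \<alpha>)"
    by (rule ct_removal[OF R_bounded card_R])
  also have "\<dots> = (\<Sum>\<alpha>\<in>{\<pi>}. ?t \<alpha>)"
    using \<pi>_in_grid[OF assms] unique_point
    by (intro sum.mono_neutral_right) (auto intro!: finite_PiE)
  finally show ?thesis by simp
qed

lemma ct_equal_parameters:
  assumes "a 1 = a (\<sigma> 2)"
  shows "ct (ser_mult (ser_monom (pref_exp Q1)) (dyson n a)) = 0"
proof -
  have "ser_eval n (\<lambda>k. qq ^ \<alpha> k) (dyson n a) = 0" if "\<alpha> \<in> PiE {..n} A" for \<alpha>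
    using unique_point(2)[OF that] assms by blast
  then show ?thesis by (subst ct_removal[OF R_bounded card_R]) auto
qed

end

subsection \<open>Evaluation at a packing\<close>

text \<open>Stands for 1 - q^(u - v), written as a quotient because u may be smaller than v.\<close>

definition qbracket :: "nat \<Rightarrow> nat \<Rightarrow> K" where
  "qbracket u v = 1 - qq ^ u / qq ^ v"

lemma qbracket_eq_0_iff [simp]: "qbracket u v = 0 \<longleftrightarrow> u = v"
  by (auto simp: qbracket_def qq_nonzero)

lemma qbracket_add: "qbracket (v + d) v = 1 - qq ^ d"
  by (simp add: qbracket_def power_add qq_nonzero)

lemma qbracket_diff: "v \<le> u \<Longrightarrow> qbracket u v = 1 - qq ^ (u - v)"
  using qbracket_add[of v "u - v"] by simp

lemma qbracket_swap: "u \<noteq> v \<Longrightarrow> qbracket u v / qbracket v u = - (qq ^ u / qq ^ v)"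
  by (simp add: qbracket_def qq_nonzero field_simps)

lemma qpochK_nonzero [simp]: "qpochK m \<noteq> 0"
  by (simp add: qpochK_def del: power_Suc)

lemma qpochK_Suc: "qpochK (Suc m) = qpochK m * (1 - qq ^ Suc m)"
  by (simp add: qpochK_def)

lemma qpochK_pred: "0 < m \<Longrightarrow> qpochK (m - 1) = qpochK m / (1 - qq ^ m)"
  by (cases m) (simp_all add: qpochK_Suc del: power_Suc)

lemma prod_qpochK:
  assumes "c \<le> d"
  shows "(\<Prod>i\<in>{c<..d}. 1 - qq ^ i) = qpochK d / qpochK c"
  using assms
proof (induction d rule: dec_induct)
  case (step d)
  then have "{c<..Suc d} = insert (Suc d) {c<..d}" by auto
  with step show ?case by (simp add: qpochK_Suc del: power_Suc)
qed simp

lemma prod_B_interval: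
  assumes "0 < c" "c \<le> d"
  shows "(\<Prod>m\<in>{v + c..<v + d}. qbracket m v) = qpochK (d - 1) / qpochK (c - 1)"
proof -
  have "(\<Prod>m\<in>{v + c..<v + d}. qbracket m v) = (\<Prod>i\<in>{c - 1<..d - 1}. 1 - qq ^ i)"
    by (rule prod.reindex_bij_witness[where i = "\<lambda>i. v + i" and j = "\<lambda>m. m - v"])
       (use assms in \<open>auto simp: qbracket_diff\<close>)
  also have "\<dots> = qpochK (d - 1) / qpochK (c - 1)"
    using assms by (intro prod_qpochK) auto
  finally show ?thesis .
qed

context dyson_tournament
begin

text \<open>Factors are grouped by the vertex k in the denominator of the ratio. An earlier vertex
  contributes its whole interval, a later one its interval without the left end, since the second
  q-factorial starts at q. The intervals tile [0, |a|), so only the interval of k and the later left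
  ends are missing.\<close>

lemma ser_eval_packing:
  assumes "packing n a \<alpha>"
  shows "ser_eval n (\<lambda>k. qq ^ \<alpha> k) (dyson n a) =
    (\<Prod>k\<le>n. \<Prod>m\<in>{..<total} - {\<alpha> k..<\<alpha> k + a k} - \<alpha> ` {k<..n}. qbracket m (\<alpha> k))"
proof -
  interpret packing n a \<alpha> by fact
  define F where "F i j = (\<Prod>t<a i. qbracket (\<alpha> i + t) (\<alpha> j))" for i j
  define G where "G i j = (\<Prod>t\<in>{1..<a j}. qbracket (\<alpha> j + t) (\<alpha> i))" for i j
  define S where "S k j = (if j < k then {\<alpha> j..<\<alpha> j + a j} else {\<alpha> j + 1..<\<alpha> j + a j})" for k j
  have "ser_eval n (\<lambda>k. qq ^ \<alpha> k) (dyson n a) = (\<Prod>i\<le>n. \<Prod>j\<in>{i<..n}. F i j * G i j)"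
    by (subst ser_eval_dyson[of n a, OF a_pos])
       (simp_all add: qq_nonzero F_def G_def qbracket_def power_add mult.commute)
  also have "\<dots> = (\<Prod>i\<le>n. \<Prod>j\<in>{i<..n}. F i j) * (\<Prod>i\<le>n. \<Prod>j\<in>{i<..n}. G i j)"
    by (simp add: prod.distrib)
  also have "(\<Prod>i\<le>n. \<Prod>j\<in>{i<..n}. F i j) = (\<Prod>i\<in>{..n}. \<Prod>j | j \<in> {..n} \<and> i < j. F i j)"
    by (intro prod.cong) auto
  also have "\<dots> = (\<Prod>j\<in>{..n}. \<Prod>i | i \<in> {..n} \<and> i < j. F i j)"
    by (rule prod.swap_restrict) auto
  also have "\<dots> = (\<Prod>j\<le>n. \<Prod>i<j. F i j)"
    by (intro prod.cong) auto
  also have "\<dots> * (\<Prod>i\<le>n. \<Prod>j\<in>{i<..n}. G i j) = (\<Prod>k\<le>n. (\<Prod>i<k. F i k) * (\<Prod>j\<in>{k<..n}. G k j))"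
    by (simp add: prod.distrib)
  also have "\<dots> = (\<Prod>k\<le>n. \<Prod>m\<in>{..<total} - {\<alpha> k..<\<alpha> k + a k} - \<alpha> ` {k<..n}. qbracket m (\<alpha> k))"
  proof (rule prod.cong[OF refl])
    fix k assume "k \<in> {..n}"
    then have k: "k \<le> n" by simp
    have F: "F i k = (\<Prod>m\<in>S k i. qbracket m (\<alpha> k))" if "i < k" for i
      unfolding F_def S_def using that
      by (intro prod.reindex_bij_witness[where i = "\<lambda>m. m - \<alpha> i" and j = "\<lambda>t. \<alpha> i + t"]) auto
    have G: "G k j = (\<Prod>m\<in>S k j. qbracket m (\<alpha> k))" if "k < j" for j
      unfolding G_def S_def using that
      by (intro prod.reindex_bij_witness[where i = "\<lambda>m. m - \<alpha> j" and j = "\<lambda>t. \<alpha> j + t"]) auto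
    have split: "{..n} - {k} = {..<k} \<union> {k<..n}" using k by auto
    have S_sub: "S k j \<subseteq> {\<alpha> j..<\<alpha> j + a j}" for j by (auto simp: S_def)
    have "(\<Prod>i<k. F i k) * (\<Prod>j\<in>{k<..n}. G k j) = (\<Prod>j\<in>{..n} - {k}. \<Prod>m\<in>S k j. qbracket m (\<alpha> k))"
      unfolding split by (subst prod.union_disjoint) (auto simp: F G)
    also have "\<dots> = (\<Prod>m\<in>(\<Union>j\<in>{..n} - {k}. S k j). qbracket m (\<alpha> k))"
    proof (rule prod.UNION_disjoint[symmetric])
      show "\<forall>i\<in>{..n} - {k}. \<forall>j\<in>{..n} - {k}. i \<noteq> j \<longrightarrow> S k i \<inter> S k j = {}"
      proof (intro ballI impI)
        fix i j assume "i \<in> {..n} - {k}" "j \<in> {..n} - {k}" "i \<noteq> j"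
        then have "{\<alpha> i..<\<alpha> i + a i} \<inter> {\<alpha> j..<\<alpha> j + a j} = {}"
          using disjoint[of i j] by force
        then show "S k i \<inter> S k j = {}" using S_sub by blast
      qed
    qed (auto simp: S_def)
    also have "(\<Union>j\<in>{..n} - {k}. S k j) = {..<total} - {\<alpha> k..<\<alpha> k + a k} - \<alpha> ` {k<..n}"
    proof (intro equalityI subsetI)
      fix m assume "m \<in> (\<Union>j\<in>{..n} - {k}. S k j)"
      then obtain j where j: "j \<le> n" "j \<noteq> k" "m \<in> S k j" by auto
      have mj: "m \<in> {\<alpha> j..<\<alpha> j + a j}" using j(3) S_sub by blast
      have "m < total" using mj bounded[OF j(1)] by simp
      moreover have "m \<notin> {\<alpha> k..<\<alpha> k + a k}" using mj disjoint[OF j(1) k j(2)] by force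
      moreover have "m \<noteq> \<alpha> j'" if "k < j'" "j' \<le> n" for j'
      proof (cases "j' = j")
        case True
        with j(3) that show ?thesis by (auto simp: S_def)
      next
        case False
        with disjoint[OF j(1) that(2)] mj a_pos[of j'] that show ?thesis by force
      qed
      then have "m \<notin> \<alpha> ` {k<..n}" by fastforce
      ultimately show "m \<in> {..<total} - {\<alpha> k..<\<alpha> k + a k} - \<alpha> ` {k<..n}" by simp
    next
      fix m assume m: "m \<in> {..<total} - {\<alpha> k..<\<alpha> k + a k} - \<alpha> ` {k<..n}"
      then have "m \<in> (\<Union>k\<le>n. {\<alpha> k..<\<alpha> k + a k})" using tiles_cover by blast
      then obtain j where j: "j \<le> n" "m \<in> {\<alpha> j..<\<alpha> j + a j}" by auto
      with m have "j \<noteq> k" by auto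
      moreover have "m \<in> S k j"
      proof (cases "j < k")
        case False
        with \<open>j \<noteq> k\<close> j(1) m have "m \<noteq> \<alpha> j" by auto
        with j False show ?thesis by (auto simp: S_def)
      qed (use j in \<open>simp add: S_def\<close>)
      ultimately show "m \<in> (\<Union>j\<in>{..n} - {k}. S k j)" using j by auto
    qed
    finally show "(\<Prod>i<k. F i k) * (\<Prod>j\<in>{k<..n}. G k j) =
      (\<Prod>m\<in>{..<total} - {\<alpha> k..<\<alpha> k + a k} - \<alpha> ` {k<..n}. qbracket m (\<alpha> k))" .
  qed
  finally show ?thesis .
qed

lemma grid_weight_eq:
  assumes "v \<in> A" "finite A"
  shows "grid_weight A v = (qq ^ v) ^ (card A - 1) * (\<Prod>m\<in>A - {v}. qbracket m v)"
proof -
  have "grid_weight A v = (\<Prod>m\<in>A - {v}. qq ^ v * qbracket m v)"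
    unfolding grid_weight_def by (intro prod.cong) (auto simp: qbracket_def qq_nonzero field_simps)
  with assms show ?thesis by (simp add: prod.distrib)
qed

lemma mono_eval_sum:
  assumes "finite S" "\<And>k. k \<le> n \<Longrightarrow> x k \<noteq> 0"
  shows "mono_eval n x (\<lambda>k. \<Sum>p\<in>S. f p k) = (\<Prod>p\<in>S. mono_eval n x (f p))"
  using assms(1) by induction (simp_all add: mono_eval_add assms(2))

lemma mono_eval_pref:
  assumes "\<And>k. k \<le> n \<Longrightarrow> x k \<noteq> 0"
  shows "mono_eval n x (pref_exp Q1) = x 0 / x 1 * (\<Prod>(i, j)\<in>Q1. x j / x i)"
proof -
  have fin: "finite Q1" by (rule finite_Q1[OF n2 Q1])
  have "mono_eval n x (pref_exp Q1) =
    mono_eval n x (evec 0 1) * mono_eval n x (\<lambda>k. \<Sum>p\<in>Q1. evec (snd p) (fst p) k)"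
    unfolding pref_exp_def case_prod_beta by (rule mono_eval_add[OF assms])
  also have "mono_eval n x (evec 0 1) = x 0 / x 1"
    using n2 by (intro mono_eval_evec) auto
  also have "mono_eval n x (\<lambda>k. \<Sum>p\<in>Q1. evec (snd p) (fst p) k) =
    (\<Prod>p\<in>Q1. mono_eval n x (evec (snd p) (fst p)))"
    by (rule mono_eval_sum[OF fin assms])
  also have "\<dots> = (\<Prod>(i, j)\<in>Q1. x j / x i)"
    by (intro prod.cong refl) (auto dest!: subsetD[OF Q1] intro!: mono_eval_evec)
  finally show ?thesis .
qed

end

section \<open>The surviving term as a product over the vertices\<close>

context transitive_dyson_tournament
begin

lemma total_eq: "total = P 2 + a 1 + a 0 + a (\<sigma> 2)"
  by (simp add: total_P_0 P_0)

lemma \<pi>_\<sigma>_end: "3 \<le> i \<Longrightarrow> i \<le> n \<Longrightarrow> \<pi> (\<sigma> i) + a (\<sigma> i) = P (i - 1)"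
  using P_step[of i] by (simp add: \<pi>_\<sigma>)

lemma packing_\<pi>: "packing n a \<pi>"
proof
  have low: "\<pi> (\<sigma> i) + a (\<sigma> i) \<le> P 2" if "3 \<le> i" "i \<le> n" for i
    using \<pi>_\<sigma>_end[OF that] P_mono[of 2 "i - 1"] that by simp
  show "\<pi> k + a k \<le> total" if "k \<le> n" for k
    using that
  proof (cases k rule: vertex_cases)
    case (4 i)
    with low[of i] show ?thesis by (simp add: total_eq)
  qed (use \<pi>_0 \<pi>_1 \<pi>_\<sigma>2 total_eq in simp_all)
  have sep: "\<pi> i + a i \<le> \<pi> j \<or> \<pi> j + a j \<le> \<pi> i" if "i = \<sigma> r" "3 \<le> r" "r \<le> n" "j \<le> n" "i \<noteq> j" for i j r
    using that(4)
  proof (cases j rule: vertex_cases)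
    case (4 s)
    have *: "\<pi> (\<sigma> s) + a (\<sigma> s) \<le> \<pi> (\<sigma> t)" if "3 \<le> t" "t < s" "s \<le> n" for s t
      using \<pi>_\<sigma>_end[of s] P_mono[of t "s - 1"] that by (simp add: \<pi>_\<sigma>)
    from 4 that *[of r s] *[of s r] show ?thesis by (cases r s rule: linorder_cases) auto
  qed (use low[of r] that \<pi>_0 \<pi>_1 \<pi>_\<sigma>2 in auto)
  show "\<pi> i + a i \<le> \<pi> j \<or> \<pi> j + a j \<le> \<pi> i" if ij: "i \<le> n" "j \<le> n" "i \<noteq> j" for i j
  proof (cases "\<exists>r. (i = \<sigma> r \<or> j = \<sigma> r) \<and> 3 \<le> r \<and> r \<le> n")
    case True
    then show ?thesis using sep[of i _ j] sep[of j _ i] ij by metis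
  next
    case False
    have "i = 0 \<or> i = 1 \<or> i = \<sigma> 2" using ij(1) False by (cases i rule: vertex_cases) auto
    moreover have "j = 0 \<or> j = 1 \<or> j = \<sigma> 2" using ij(2) False by (cases j rule: vertex_cases) auto
    ultimately show ?thesis using ij(3) \<pi>_0 \<pi>_1 \<pi>_\<sigma>2 by auto
  qed
qed

sublocale packing n a \<pi>
  by (rule packing_\<pi>)

definition factor :: "nat \<Rightarrow> K" where
  "factor k = (\<Prod>m\<in>{..<total} - {\<pi> k..<\<pi> k + a k} - \<pi> ` {k<..n}. qbracket m (\<pi> k)) /
              (\<Prod>m\<in>A k - {\<pi> k}. qbracket m (\<pi> k))"

text \<open>\<open>card (A k) - 1\<close> differs from the shift by the prefactor's exponent, so the
  powers of q split off from the Lagrange denominators leave the prefactor evaluated at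
  \<pi>.\<close>

lemma ct_factors:
  assumes "a 1 \<noteq> a (\<sigma> 2)"
  shows "ct (ser_mult (ser_monom (pref_exp Q1)) (dyson n a)) =
    mono_eval n (\<lambda>k. qq ^ \<pi> k) (pref_exp Q1) * (\<Prod>k\<le>n. factor k)"
proof -
  have "(qq ^ \<pi> k) ^ dyson_shift n a k / grid_weight (A k) (\<pi> k) =
      (qq ^ \<pi> k) powi pref_exp Q1 k / (\<Prod>m\<in>A k - {\<pi> k}. qbracket m (\<pi> k))" if k: "k \<le> n" for k
  proof -
    have mem: "\<pi> k \<in> A k" using \<pi>_in_grid[OF assms] k by auto
    then have "0 < card (A k)" by (auto simp: card_gt_0_iff)
    with card_grid_set[OF R_bounded card_R k]
    have *: "pref_exp Q1 k = int (dyson_shift n a k) - int (card (A k) - 1)" by simp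
    have "(qq ^ \<pi> k) powi pref_exp Q1 k = (qq ^ \<pi> k) ^ dyson_shift n a k / (qq ^ \<pi> k) ^ (card (A k) - 1)"
      unfolding * by (subst power_int_diff) (simp_all add: qq_nonzero)
    then show ?thesis
      by (subst grid_weight_eq[OF mem]) simp_all
  qed
  then show ?thesis
    unfolding ct_single_term[OF assms] ser_eval_packing[OF packing_\<pi>] factor_def mono_eval_def
    by (simp add: prod.distrib[symmetric] prod_dividef[symmetric] mult.commute)
qed

text \<open>Positions below \<pi> k cancel. Above it the numerator runs over [\<pi> k + a k, |a|)
  and the denominator over (\<pi> k, |a| - a k], which gives the q-factorials; the left ends of
  later vertices and the removed positions \<open>R k\<close> are the corrections.\<close>

lemma factor_pos:
  assumes "a 1 \<noteq> a (\<sigma> 2)" "1 \<le> k" "k \<le> n"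
  shows "factor k = qpochK (total - \<pi> k - 1) / (qpochK (a k - 1) * qpochK (total - \<pi> k - a k)) *
    ((\<Prod>m\<in>R k. qbracket m (\<pi> k)) / (\<Prod>j\<in>{k<..n}. qbracket (\<pi> j) (\<pi> k)))"
proof -
  let ?v = "\<pi> k" and ?T = "total"
  have ak: "0 < a k" using a_pos[of k] assms by simp
  have stop: "?v + a k \<le> ?T" using bounded assms by simp
  have vA: "?v \<in> A k" using \<pi>_in_grid[OF assms(1)] assms by auto
  have disj: "\<pi> j \<notin> {?v..<?v + a k}" if "k < j" "j \<le> n" for j
    using disjoint[of k j] a_pos[of j] that assms by auto
  have inj: "inj_on \<pi> {k<..n}"
  proof (rule inj_onI, rule ccontr)
    fix i j assume "i \<in> {k<..n}" "j \<in> {k<..n}" "\<pi> i = \<pi> j" "i \<noteq> j"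
    then show False using disjoint[of i j] a_pos[of i] a_pos[of j] by auto
  qed
  let ?H = "\<Prod>m<?v. qbracket m ?v"
  define U where "U = {..<?T} - {?v..<?v + a k} - \<pi> ` {k<..n}"
  have "(\<Prod>m\<in>U. qbracket m ?v) * (\<Prod>j\<in>{k<..n}. qbracket (\<pi> j) ?v) = (\<Prod>m\<in>{..<?T} - {?v..<?v + a k}. qbracket m ?v)"
  proof -
    have sub: "\<pi> ` {k<..n} \<subseteq> {..<?T} - {?v..<?v + a k}"
    proof (rule image_subsetI)
      fix j assume "j \<in> {k<..n}"
      with disj[of j] bounded[of j] a_pos[of j] show "\<pi> j \<in> {..<?T} - {?v..<?v + a k}" by auto
    qed
    have "(\<Prod>j\<in>{k<..n}. qbracket (\<pi> j) ?v) = (\<Prod>m\<in>\<pi> ` {k<..n}. qbracket m ?v)"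
      by (simp add: prod.reindex[OF inj])
    then show ?thesis
      unfolding U_def using prod.subset_diff[OF sub, of "\<lambda>m. qbracket m ?v"] by simp
  qed
  also have "{..<?T} - {?v..<?v + a k} = {..<?v} \<union> {?v + a k..<?v + (?T - ?v)}"
    using stop by auto
  also have "(\<Prod>m\<in>\<dots>. qbracket m ?v) = ?H * (qpochK (?T - ?v - 1) / qpochK (a k - 1))"
    using prod_B_interval[of "a k" "?T - ?v" ?v] ak stop
    by (subst prod.union_disjoint) auto
  finally have 1: "(\<Prod>m\<in>U. qbracket m ?v) * (\<Prod>j\<in>{k<..n}. qbracket (\<pi> j) ?v) =
    ?H * (qpochK (?T - ?v - 1) / qpochK (a k - 1))" .
  have "(\<Prod>m\<in>A k - {?v}. qbracket m ?v) * (\<Prod>m\<in>R k. qbracket m ?v) = (\<Prod>m\<in>{..?T - a k} - {?v}. qbracket m ?v)"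
  proof -
    have sub: "R k \<subseteq> {..?T - a k} - {?v}" using R_bounded[of k] vA assms by auto
    have "A k - {?v} = {..?T - a k} - {?v} - R k" by auto
    then show ?thesis using prod.subset_diff[OF sub, of "\<lambda>m. qbracket m ?v"] by simp
  qed
  also have "{..?T - a k} - {?v} = {..<?v} \<union> {?v + 1..<?v + (?T - ?v - a k + 1)}"
    using stop by auto
  also have "(\<Prod>m\<in>\<dots>. qbracket m ?v) = ?H * qpochK (?T - ?v - a k)"
    using prod_B_interval[of 1 "?T - ?v - a k + 1" ?v]
    by (subst prod.union_disjoint) (auto simp: qpochK_def)
  finally have 2: "(\<Prod>m\<in>A k - {?v}. qbracket m ?v) * (\<Prod>m\<in>R k. qbracket m ?v) = ?H * qpochK (?T - ?v - a k)" .
  have "\<pi> j \<noteq> ?v" if "j \<in> {k<..n}" for j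
    using disj[of j] ak that by auto
  then have nz: "?H \<noteq> 0" "(\<Prod>j\<in>{k<..n}. qbracket (\<pi> j) ?v) \<noteq> 0" "(\<Prod>m\<in>A k - {?v}. qbracket m ?v) \<noteq> 0"
    by auto
  have "?v \<notin> R k" "finite (R k)"
    using vA R_bounded[of k] assms by (auto intro: finite_subset)
  then have nzR: "(\<Prod>m\<in>R k. qbracket m ?v) \<noteq> 0" by auto
  from 1 nz have X: "(\<Prod>m\<in>U. qbracket m ?v) =
    ?H * (qpochK (?T - ?v - 1) / qpochK (a k - 1)) / (\<Prod>j\<in>{k<..n}. qbracket (\<pi> j) ?v)"
    by (simp add: field_simps)
  from 2 nzR have Y: "(\<Prod>m\<in>A k - {?v}. qbracket m ?v) =
    ?H * qpochK (?T - ?v - a k) / (\<Prod>m\<in>R k. qbracket m ?v)"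
    by (simp add: field_simps)
  show ?thesis
    unfolding factor_def U_def[symmetric] X Y using nz nzR by (simp add: field_simps)
qed

text \<open>\<open>factor_pos\<close> does not cover this: if \<open>a 0 = 0\<close>, vertex
  \<sigma> 2 shares the left end of 0 and a denominator would vanish. Here the removed values
  \<open>P 2, ..., P n\<close> are also left ends and cancel; \<open>P 0\<close> is the end of the
  range, and \<open>P 1\<close> leaves the bracket.\<close>

lemma factor_0:
  assumes "a 1 \<noteq> a (\<sigma> 2)"
  shows "factor 0 = qbracket (P 1) (\<pi> 0) * qpochK (a 0 + a (\<sigma> 2) - 1) /
    (qpochK (a 0) * qpochK (a (\<sigma> 2) - 1))"
proof -
  let ?v = "\<pi> 0" and ?b = "\<sigma> 2"
  have pos: "0 < a 1" "0 < a ?b" using a_pos[of 1] a_\<sigma>_pos[of 2] n2 by auto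
  have P_le: "P i \<le> P 2" if "2 \<le> i" "i \<le> n" for i using P_mono[of 2 i] that by simp
  define S where "S = P ` {2..n}"
  have S: "m < ?v" if "m \<in> S" for m
    using that P_le pos by (force simp: S_def \<pi>_0)
  define X where "X = {..<?v} - S"
  have \<pi>_image: "\<pi> ` {0<..n} = insert (?v + a 0) (S)"
  proof -
    have "{0<..n} = \<sigma> ` {1..n}" unfolding \<sigma>_image by auto
    also have "{1..n} = insert 1 (insert 2 {3..n})" using n2 by auto
    finally have "\<pi> ` {0<..n} = insert (\<pi> (\<sigma> 1)) (insert (\<pi> ?b) ((\<lambda>i. \<pi> (\<sigma> i)) ` {3..n}))"
      by (simp add: image_image)
    also have "(\<lambda>i. \<pi> (\<sigma> i)) ` {3..n} = P ` {3..n}"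
      by (intro image_cong) (auto simp: \<pi>_\<sigma>)
    also have "insert (\<pi> (\<sigma> 1)) (insert (\<pi> ?b) (P ` {3..n})) = insert (?v + a 0) (P ` (insert 2 {3..n}))"
      using \<sigma>_1 \<pi>_1 \<pi>_\<sigma>2 \<pi>_0 by auto
    also have "insert 2 {3..n} = {2..n}" using n2 by auto
    finally show ?thesis by (simp add: S_def)
  qed
  have U: "{..<total} - {?v..<?v + a 0} - \<pi> ` {0<..n} =
      X \<union> {?v + (a 0 + 1)..<?v + (a 0 + a ?b)}"
  proof -
    have "total = ?v + a 0 + a ?b" by (simp add: total_eq \<pi>_0)
    then show ?thesis unfolding \<pi>_image X_def by (auto dest: S)
  qed
  have "(\<Prod>m\<in>{..<total} - {?v..<?v + a 0} - \<pi> ` {0<..n}. qbracket m ?v) =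
      (\<Prod>m\<in>X. qbracket m ?v) * (qpochK (a 0 + a ?b - 1) / qpochK (a 0))"
    unfolding U using pos prod_B_interval[of "a 0 + 1" "a 0 + a ?b" ?v]
    by (subst prod.union_disjoint) (auto simp: X_def)
  moreover have "(\<Prod>m\<in>A 0 - {?v}. qbracket m ?v) * qbracket (P 1) ?v = (\<Prod>m\<in>X. qbracket m ?v) * qpochK (a ?b - 1)"
  proof -
    have P01: "P ` {..n} = insert (P 0) (insert (P 1) (S))"
    proof -
      have "{..n} = insert 0 (insert 1 {2..n})" using n2 by auto
      then show ?thesis unfolding S_def by (metis image_insert)
    qed
    have P0: "P 0 = ?v + a ?b" by (simp add: P_0 \<pi>_0)
    have P1: "P 1 < P 0" "P 1 \<noteq> ?v" using pos assms P_0 P_1 \<pi>_0 by simp_all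
    have P1S: "P 1 \<notin> S"
    proof
      assume "P 1 \<in> S"
      then obtain i where "2 \<le> i" "i \<le> n" "P 1 = P i" by (auto simp: S_def)
      with P_less[of 1 i] show False by simp
    qed
    have tot: "total - a 0 = P 0" by (simp add: total_P_0)
    have *: "X \<union> {?v + 1..<?v + a ?b} = insert (P 1) (A 0 - {?v})"
      unfolding R_0 P01 tot X_def using P1 P1S P0 by (auto dest: S)
    have "P 1 \<notin> A 0 - {?v}" unfolding R_0 P01 by simp
    then have "(\<Prod>m\<in>A 0 - {?v}. qbracket m ?v) * qbracket (P 1) ?v = (\<Prod>m\<in>X \<union> {?v + 1..<?v + a ?b}. qbracket m ?v)"
      unfolding * by (subst prod.insert) simp_all
    also have "\<dots> = (\<Prod>m\<in>X. qbracket m ?v) * qpochK (a ?b - 1)"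
      using pos prod_B_interval[of 1 "a ?b" ?v]
      by (subst prod.union_disjoint) (auto simp: X_def qpochK_def)
    finally show ?thesis .
  qed
  moreover have "qbracket (P 1) ?v \<noteq> 0" using assms P_1 \<pi>_0 by simp
  moreover have "(\<Prod>m\<in>X. qbracket m ?v) \<noteq> 0" by (auto simp: X_def)
  ultimately have Y: "(\<Prod>m\<in>A 0 - {?v}. qbracket m ?v) = (\<Prod>m\<in>X. qbracket m ?v) * qpochK (a ?b - 1) / qbracket (P 1) ?v"
    and X: "(\<Prod>m\<in>{..<total} - {?v..<?v + a 0} - \<pi> ` {0<..n}. qbracket m ?v) =
      (\<Prod>m\<in>X. qbracket m ?v) * (qpochK (a 0 + a ?b - 1) / qpochK (a 0))"
    by (simp_all add: field_simps)
  show ?thesis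
    unfolding factor_def X Y using \<open>(\<Prod>m\<in>X. qbracket m ?v) \<noteq> 0\<close> by simp
qed

end

section \<open>Evaluation of the product of the factors\<close>

context transitive_dyson_tournament
begin

lemma prod_Q1_group:
  fixes f :: "nat \<Rightarrow> nat \<Rightarrow> K"
  shows "(\<Prod>k\<in>{2..n}. \<Prod>i | (i, k) \<in> Q1. f i k) = (\<Prod>(i, j)\<in>Q1. f i j)"
    and "(\<Prod>k\<in>{2..n}. \<Prod>j | (k, j) \<in> Q1. f k j) = (\<Prod>(i, j)\<in>Q1. f i j)"
proof -
  have fin: "finite Q1" by (rule finite_Q1[OF n2 Q1])
  have "(\<Prod>(i, j)\<in>Q1. f i j) = (\<Prod>k\<in>{2..n}. \<Prod>p | p \<in> Q1 \<and> snd p = k. f (fst p) (snd p))"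
    using Q1 fin by (subst prod.group) (auto simp: case_prod_beta)
  also have "\<dots> = (\<Prod>k\<in>{2..n}. \<Prod>i | (i, k) \<in> Q1. f i k)"
    by (intro prod.cong refl prod.reindex_bij_witness[where i = "\<lambda>i. (i, _)" and j = fst]) auto
  finally show "(\<Prod>k\<in>{2..n}. \<Prod>i | (i, k) \<in> Q1. f i k) = (\<Prod>(i, j)\<in>Q1. f i j)" ..
  have "(\<Prod>(i, j)\<in>Q1. f i j) = (\<Prod>k\<in>{2..n}. \<Prod>p | p \<in> Q1 \<and> fst p = k. f (fst p) (snd p))"
    using Q1 fin by (subst prod.group) (auto simp: case_prod_beta)
  also have "\<dots> = (\<Prod>k\<in>{2..n}. \<Prod>j | (k, j) \<in> Q1. f k j)"
    by (intro prod.cong refl prod.reindex_bij_witness[where i = "\<lambda>j. (_, j)" and j = snd]) auto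
  finally show "(\<Prod>k\<in>{2..n}. \<Prod>j | (k, j) \<in> Q1. f k j) = (\<Prod>(i, j)\<in>Q1. f i j)" ..
qed

lemma \<pi>_neq: "1 \<le> i \<Longrightarrow> i \<le> n \<Longrightarrow> 1 \<le> j \<Longrightarrow> j \<le> n \<Longrightarrow> i \<noteq> j \<Longrightarrow> \<pi> i \<noteq> \<pi> j"
  using disjoint[of i j] a_pos[of i] a_pos[of j] by auto

text \<open>The corrections in \<open>factor_pos\<close>; the remaining quotient of q-factorials is
  \<open>height\<close>.\<close>

definition weight :: "nat \<Rightarrow> K" where
  "weight k = (\<Prod>m\<in>R k. qbracket m (\<pi> k)) / (\<Prod>j\<in>{k<..n}. qbracket (\<pi> j) (\<pi> k))"

text \<open>\<open>R k\<close> consists of the left ends of the out-neighbours of k. Those after k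
  in the numbering cancel against the denominator, which leaves the earlier beaten ones above and
  the later unbeaten ones below: the pairs of \<open>Q1\<close>.\<close>

lemma weight_ge_2:
  assumes "2 \<le> k" "k \<le> n"
  shows "weight k = (\<Prod>i | (i, k) \<in> Q1. qbracket (\<pi> i) (\<pi> k)) / (\<Prod>j | (k, j) \<in> Q1. qbracket (\<pi> j) (\<pi> k))"
proof -
  define C where "C = {j\<in>{k<..n}. (k, j) \<notin> Q1}"
  define I where "I = {i. (i, k) \<in> Q1}"
  define J where "J = {j. (k, j) \<in> Q1}"
  have fin: "finite C" "finite I" "finite J"
    using finite_Q1_sections[OF n2 Q1] by (simp_all add: C_def I_def J_def)
  have above: "{k<..n} = C \<union> J" using Q1 by (auto simp: C_def J_def)
  have out: "out_nbrs n Q1 k = C \<union> I"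
    using Q1 assms by (auto simp: out_nbrs_def C_def I_def beats_def)
  have disj: "C \<inter> J = {}" "C \<inter> I = {}" using Q1 by (auto simp: C_def I_def J_def)
  obtain i where i: "1 \<le> i" "i \<le> n" "k = \<sigma> i" using \<sigma>_cases[of k] assms by auto
  have i2: "2 \<le> i" using i assms \<sigma>_1 by (cases "i = 1") auto
  have "R k = P ` {i<..n}" using i i2 by (simp add: R_\<sigma>)
  also have "\<dots> = \<pi> ` \<sigma> ` {i<..n}"
    unfolding image_image using i2 by (intro image_cong) (auto simp: \<pi>_\<sigma>)
  also have "\<dots> = \<pi> ` (C \<union> I)" using out_nbrs_\<sigma>[OF i2 i(2)] i(3) out by simp
  finally have R: "R k = \<pi> ` (C \<union> I)" .
  have sub: "C \<union> I \<subseteq> {1..n}" using assms Q1 by (auto simp: C_def I_def)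
  have "inj_on \<pi> (C \<union> I)"
  proof (rule inj_onI, rule ccontr)
    fix x y assume "x \<in> C \<union> I" "y \<in> C \<union> I" "\<pi> x = \<pi> y" "x \<noteq> y"
    with sub \<pi>_neq[of x y] show False by (auto simp: subset_iff)
  qed
  then have num: "(\<Prod>m\<in>R k. qbracket m (\<pi> k)) = (\<Prod>j\<in>C. qbracket (\<pi> j) (\<pi> k)) * (\<Prod>j\<in>I. qbracket (\<pi> j) (\<pi> k))"
    unfolding R using fin disj by (simp add: prod.reindex prod.union_disjoint)
  have den: "(\<Prod>j\<in>{k<..n}. qbracket (\<pi> j) (\<pi> k)) = (\<Prod>j\<in>C. qbracket (\<pi> j) (\<pi> k)) * (\<Prod>j\<in>J. qbracket (\<pi> j) (\<pi> k))"
    unfolding above using fin disj by (simp add: prod.union_disjoint)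
  have "\<pi> j \<noteq> \<pi> k" if "j \<in> C" for j
    using that assms by (intro \<pi>_neq) (auto simp: C_def)
  then have "(\<Prod>j\<in>C. qbracket (\<pi> j) (\<pi> k)) \<noteq> 0" using fin by simp
  then show ?thesis unfolding weight_def num den by (simp add: I_def J_def)
qed

text \<open>A pair (i, j) of \<open>Q1\<close> enters the numerator at j and the denominator at i
  with its entries exchanged. By \<open>qbracket_swap\<close> the quotient is minus the inverse of
  its monomial in the prefactor: this is the source of the sign.\<close>

lemma prod_weight_ge_2:
  "(\<Prod>k\<in>{2..n}. weight k) = (-1) ^ card Q1 / (\<Prod>(i, j)\<in>Q1. qq ^ \<pi> j / qq ^ \<pi> i)"
proof -
  have "(\<Prod>k\<in>{2..n}. weight k) = (\<Prod>k\<in>{2..n}.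
    (\<Prod>i | (i, k) \<in> Q1. qbracket (\<pi> i) (\<pi> k)) / (\<Prod>j | (k, j) \<in> Q1. qbracket (\<pi> j) (\<pi> k)))"
    by (intro prod.cong) (auto simp: weight_ge_2)
  also have "\<dots> = (\<Prod>(i, j)\<in>Q1. qbracket (\<pi> i) (\<pi> j)) / (\<Prod>(i, j)\<in>Q1. qbracket (\<pi> j) (\<pi> i))"
    unfolding prod_dividef prod_Q1_group(1)[of "\<lambda>i k. qbracket (\<pi> i) (\<pi> k)"]
      prod_Q1_group(2)[of "\<lambda>k j. qbracket (\<pi> j) (\<pi> k)"] ..
  also have "\<dots> = (\<Prod>(i, j)\<in>Q1. - 1 / (qq ^ \<pi> j / qq ^ \<pi> i))"
    unfolding prod_dividef[symmetric]
  proof (rule prod.cong[OF refl])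
    fix p assume "p \<in> Q1"
    moreover obtain i j where p: "p = (i, j)" by (cases p)
    ultimately have "\<pi> i \<noteq> \<pi> j" using Q1 by (intro \<pi>_neq) auto
    then show "(case p of (i, j) \<Rightarrow> qbracket (\<pi> i) (\<pi> j)) / (case p of (i, j) \<Rightarrow> qbracket (\<pi> j) (\<pi> i)) =
      (case p of (i, j) \<Rightarrow> - 1 / (qq ^ \<pi> j / qq ^ \<pi> i))"
      by (simp add: p qbracket_swap)
  qed
  also have "\<dots> = (-1) ^ card Q1 / (\<Prod>(i, j)\<in>Q1. qq ^ \<pi> j / qq ^ \<pi> i)"
    by (simp only: case_prod_unfold prod_dividef prod_constant)
  finally show ?thesis .
qed

text \<open>\<open>R 1\<close> lacks only the left end of \<sigma> 2 among the left ends of {2..n};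
  the one bracket left over supplies the denominator for i = 1 that is missing from
  \<open>prod_height\<close>.\<close>

lemma weight_1: "weight 1 = 1 / (1 - qq ^ (a 0 + a 1))"
proof -
  have "{1<..n} = {2..n}" by auto
  also have "\<dots> = \<sigma> ` {2..n}" by (simp add: \<sigma>_image_2)
  also have "{2..n} = insert 2 {2<..n}" using n2 by auto
  finally have set: "{1<..n} = insert (\<sigma> 2) (\<sigma> ` {2<..n})" by simp
  have "R 1 = \<pi> ` \<sigma> ` {2<..n}"
    unfolding R_1 image_image by (intro image_cong) (auto simp: \<pi>_\<sigma>)
  moreover have "inj_on \<pi> (\<sigma> ` {2<..n})"
  proof (rule inj_onI, rule ccontr)
    fix x y assume *: "x \<in> \<sigma> ` {2<..n}" "y \<in> \<sigma> ` {2<..n}" "\<pi> x = \<pi> y" "x \<noteq> y"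
    then have "x \<in> {1<..n}" "y \<in> {1<..n}" unfolding set by auto
    with * \<pi>_neq[of x y] show False by auto
  qed
  ultimately have num: "(\<Prod>m\<in>R 1. qbracket m (\<pi> 1)) = (\<Prod>j\<in>\<sigma> ` {2<..n}. qbracket (\<pi> j) (\<pi> 1))"
    by (simp add: prod.reindex)
  have den: "(\<Prod>j\<in>{1<..n}. qbracket (\<pi> j) (\<pi> 1)) = qbracket (\<pi> (\<sigma> 2)) (\<pi> 1) * (\<Prod>j\<in>\<sigma> ` {2<..n}. qbracket (\<pi> j) (\<pi> 1))"
    unfolding set by (subst prod.insert) auto
  have "\<pi> j \<noteq> \<pi> 1" if "j \<in> \<sigma> ` {2<..n}" for j
  proof -
    have "j \<in> {1<..n}" using that unfolding set by simp
    then show ?thesis by (intro \<pi>_neq) auto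
  qed
  then have nz: "(\<Prod>j\<in>\<sigma> ` {2<..n}. qbracket (\<pi> j) (\<pi> 1)) \<noteq> 0" by simp
  have "qbracket (\<pi> (\<sigma> 2)) (\<pi> 1) = 1 - qq ^ (a 0 + a 1)"
    using qbracket_add[of "P 2" "a 0 + a 1"] by (simp only: \<pi>_\<sigma>2 \<pi>_1 add.assoc add.commute[of "a 0"])
  with nz show ?thesis unfolding weight_def num den by simp
qed

text \<open>The exponent a_0 + \<sigma>_i of the closed form; by \<open>total_minus_P\<close> it is
  the length to the right of \<open>P i\<close>.\<close>

definition tail :: "nat \<Rightarrow> nat" where
  "tail i = a 0 + (\<Sum>k=1..i. a (\<sigma> k))"

lemma tail_Suc: "tail (Suc i) = tail i + a (\<sigma> (Suc i))"
  by (simp add: tail_def)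

lemma total_minus_P:
  assumes "i \<le> n"
  shows "total = P i + tail i"
  using assms
proof (induction rule: inc_induct)
  case base
  have "P 0 = (\<Sum>k\<in>{1..n}. a (\<sigma> k))"
    unfolding P_def by (rule sum.cong) auto
  then show ?case by (simp add: total_P_0 tail_def) (simp add: P_def)
next
  case (step i)
  then show ?case using P_step[of "Suc i"] by (simp add: tail_Suc)
qed

lemma tail_pos: "1 \<le> i \<Longrightarrow> i \<le> n \<Longrightarrow> 0 < tail i"
  using a_\<sigma>_pos[of i] by (cases i) (auto simp: tail_Suc)

lemma tail_1: "tail 1 = a 0 + a 1"
  using \<sigma>_1 by (simp add: tail_def)

lemma tail_2: "tail 2 = a 0 + a 1 + a (\<sigma> 2)"
  using tail_Suc[of 1] tail_1 by (simp add: numeral_2_eq_2)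

definition height :: "nat \<Rightarrow> K" where
  "height k = qpochK (total - \<pi> k - 1) / (qpochK (a k - 1) * qpochK (total - \<pi> k - a k))"

lemma prod_telescope:
  fixes f :: "nat \<Rightarrow> K"
  assumes "\<And>i. f i \<noteq> 0" "m \<le> l"
  shows "(\<Prod>i\<in>{m<..l}. f i / f (i - 1)) = f l / f m"
  using assms(2)
proof (induction rule: dec_induct)
  case (step l)
  then have "{m<..Suc l} = insert (Suc l) {m<..l}" by auto
  with step assms(1) show ?case by simp
qed (use assms(1) in simp)

text \<open>Split so that the first quotient telescopes in i.\<close>

lemma height_\<sigma>:
  assumes "3 \<le> i" "i \<le> n"
  shows "height (\<sigma> i) = qpochK (tail i) / qpochK (tail (i - 1)) *
    ((1 - qq ^ a (\<sigma> i)) / qpochK (a (\<sigma> i)) / (1 - qq ^ tail i))"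
proof -
  have 1: "total - \<pi> (\<sigma> i) = tail i"
    using total_minus_P[of i] assms by (simp add: \<pi>_\<sigma>)
  have 2: "tail i - a (\<sigma> i) = tail (i - 1)"
    using tail_Suc[of "i - 1"] assms by simp
  show ?thesis
    unfolding height_def 1 2 using tail_pos[of i] a_\<sigma>_pos[of i] assms
    by (simp add: qpochK_pred del: One_nat_def)
qed

text \<open>Vertex 1 occupies the place of \<sigma> 2, so the sequence of q-factorials ends in
  \<open>a 0 + a (\<sigma> 2)\<close> and not in \<open>tail 1\<close>.\<close>

lemma height_1:
  "height 1 = qpochK (tail 2) / qpochK (a 0 + a (\<sigma> 2)) *
    ((1 - qq ^ a 1) / qpochK (a 1) / (1 - qq ^ tail 2))"
proof -
  have 1: "total - \<pi> 1 = tail 2"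
    using total_minus_P[of 2] n2 \<pi>_1 by simp
  have 2: "tail 2 - a 1 = a 0 + a (\<sigma> 2)" by (simp add: tail_2)
  show ?thesis
    unfolding height_def 1 2 using tail_pos[of 2] a_pos[of 1] n2
    by (simp add: qpochK_pred del: One_nat_def)
qed

lemma height_\<sigma>2: "height (\<sigma> 2) = 1"
proof -
  have "total - \<pi> (\<sigma> 2) = a (\<sigma> 2)" by (simp add: total_eq \<pi>_\<sigma>2)
  then show ?thesis by (simp add: height_def) (simp add: qpochK_def)
qed

text \<open>The q-factorial of \<open>a 0 + a (\<sigma> 2)\<close> in the denominator is cancelled
  by \<open>factor 0\<close>, which also supplies the missing term for \<sigma> 2.\<close>

lemma prod_height:
  "(\<Prod>k\<in>{1..n}. height k) = qpochK total / qpochK (a 0 + a (\<sigma> 2)) *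
    ((\<Prod>i\<in>{1..n}. (1 - qq ^ a (\<sigma> i)) / qpochK (a (\<sigma> i))) /
       ((1 - qq ^ a (\<sigma> 2)) / qpochK (a (\<sigma> 2)))) /
    (\<Prod>i\<in>{2..n}. 1 - qq ^ tail i)"
proof -
  define g where "g i = (1 - qq ^ a (\<sigma> i)) / qpochK (a (\<sigma> i))" for i
  have set: "{1..n} = insert 1 (insert 2 {2<..n})" "{2..n} = insert 2 {2<..n}" using n2 by auto
  have g0: "g i \<noteq> 0" if "1 \<le> i" "i \<le> n" for i
    using a_\<sigma>_pos[OF that] by (simp add: g_def)
  have "(\<Prod>k\<in>{1..n}. height k) = (\<Prod>i\<in>{1..n}. height (\<sigma> i))"
    using prod.reindex[OF \<sigma>_inj_on, of height "{1..n}"] \<sigma>_image by simp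
  also have "\<dots> = height (\<sigma> 1) * (height (\<sigma> 2) * (\<Prod>i\<in>{2<..n}. height (\<sigma> i)))"
    unfolding set by simp
  also have "(\<Prod>i\<in>{2<..n}. height (\<sigma> i)) =
      (\<Prod>i\<in>{2<..n}. qpochK (tail i) / qpochK (tail (i - 1)) * (g i / (1 - qq ^ tail i)))"
    by (intro prod.cong) (auto simp: height_\<sigma> g_def)
  also have "\<dots> = qpochK (tail n) / qpochK (tail 2) *
      ((\<Prod>i\<in>{2<..n}. g i) / (\<Prod>i\<in>{2<..n}. 1 - qq ^ tail i))"
    unfolding prod.distrib prod_dividef[symmetric]
    using n2 prod_telescope[of "\<lambda>i. qpochK (tail i)" 2 n] by (simp add: prod_dividef)
  also have "tail n = total"
    using total_minus_P[of n] by (simp add: P_def)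
  finally have "(\<Prod>k\<in>{1..n}. height k) = height 1 *
      (qpochK total / qpochK (tail 2) * ((\<Prod>i\<in>{2<..n}. g i) / (\<Prod>i\<in>{2<..n}. 1 - qq ^ tail i)))"
    by (simp only: height_\<sigma>2 \<sigma>_1 mult_1)
  also have "height 1 = qpochK (tail 2) / qpochK (a 0 + a (\<sigma> 2)) * (g 1 / (1 - qq ^ tail 2))"
    using height_1 \<sigma>_1 by (simp add: g_def)
  also have "(\<Prod>i\<in>{2<..n}. g i) = (\<Prod>i\<in>{1..n}. g i) / g 2 / g 1"
    unfolding set(1) using g0[of 1] g0[of 2] n2 by simp
  also have "(\<Prod>i\<in>{2<..n}. 1 - qq ^ tail i) = (\<Prod>i\<in>{2..n}. 1 - qq ^ tail i) / (1 - qq ^ tail 2)"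
    unfolding set(2) using tail_pos[of 2] n2 by simp
  finally show ?thesis
    unfolding g_def[symmetric] using g0[of 1] tail_pos[of 2] n2 by simp
qed

lemma ct_transitive:
  "ct (ser_mult (ser_monom (pref_exp Q1)) (dyson n a)) =
    (-1) ^ card Q1
    * ((qq ^ a (\<sigma> 1) - qq ^ a (\<sigma> 2)) / (1 - qq ^ (a 0 + a (\<sigma> 2))))
    * (qpochK (\<Sum>i\<le>n. a i) / (\<Prod>i\<le>n. qpochK (a i)))
    * (\<Prod>i=1..n. (1 - qq ^ a i) / (1 - qq ^ (a 0 + (\<Sum>k=1..i. a (\<sigma> k)))))"
proof (cases "a 1 = a (\<sigma> 2)")
  case True
  with ct_equal_parameters[OF True] \<sigma>_1 show ?thesis by simp
next
  case False
  define c where "c = a 0 + a (\<sigma> 2)"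
  define M where "M = (\<Prod>(i, j)\<in>Q1. qq ^ \<pi> j / qq ^ \<pi> i)"
  define G where "G = (\<Prod>i\<in>{1..n}. (1 - qq ^ a i) / qpochK (a i))"
  define D where "D = (\<Prod>i\<in>{1..n}. 1 - qq ^ tail i)"
  have M0: "M \<noteq> 0" using finite_Q1[OF n2 Q1] by (auto simp: M_def qq_nonzero case_prod_beta)
  have pos: "0 < a (\<sigma> 2)" using a_\<sigma>_pos[of 2] n2 by simp
  have D: "D = (1 - qq ^ tail 1) * (\<Prod>i\<in>{2..n}. 1 - qq ^ tail i)"
  proof -
    have "{1..n} = insert 1 {2..n}" using n2 by auto
    then show ?thesis by (simp add: D_def)
  qed
  have G: "(\<Prod>i\<in>{1..n}. (1 - qq ^ a (\<sigma> i)) / qpochK (a (\<sigma> i))) = G"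
    unfolding G_def
    using prod.reindex[OF \<sigma>_inj_on, of "\<lambda>k. (1 - qq ^ a k) / qpochK (a k)" "{1..n}"] \<sigma>_image by simp
  have "(\<Prod>k\<in>{1..n}. factor k) = (\<Prod>k\<in>{1..n}. height k) * (\<Prod>k\<in>{1..n}. weight k)"
    unfolding prod.distrib[symmetric]
    by (intro prod.cong) (auto simp: factor_pos[OF False] height_def weight_def)
  also have "{1..n} = insert 1 {2..n}" using n2 by auto
  also have "(\<Prod>k\<in>insert 1 {2..n}. weight k) = (-1) ^ card Q1 / M / (1 - qq ^ tail 1)"
    using prod_weight_ge_2 weight_1 tail_1 by (simp add: M_def)
  also have "insert 1 {2..n} = {1..n}" using n2 by auto
  finally have pf: "(\<Prod>k\<in>{1..n}. factor k) = qpochK total / qpochK c *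
      (G / ((1 - qq ^ a (\<sigma> 2)) / qpochK (a (\<sigma> 2)))) * ((-1) ^ card Q1 / M) / D"
    unfolding prod_height G D c_def by simp
  have f0: "factor 0 = qbracket (P 1) (\<pi> 0) * (qpochK c / (1 - qq ^ c)) /
      (qpochK (a 0) * (qpochK (a (\<sigma> 2)) / (1 - qq ^ a (\<sigma> 2))))"
    unfolding factor_0[OF False] c_def using pos by (simp add: qpochK_pred del: One_nat_def)
  \<comment> \<open>Here \<pi> 0 - \<pi> 1 is \<open>a 1\<close> and \<open>P 1\<close> - \<pi> 0 is
    \<open>a (\<sigma> 2)\<close> - \<open>a 1\<close>, so x_0 / x_1 times the bracket is the
    numerator of the closed form.\<close>
  have head: "qq ^ \<pi> 0 / qq ^ \<pi> 1 * qbracket (P 1) (\<pi> 0) = qq ^ a (\<sigma> 1) - qq ^ a (\<sigma> 2)"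
    unfolding \<pi>_0 \<pi>_1 P_1 \<sigma>_1 qbracket_def by (simp add: power_add qq_nonzero field_simps)
  have "{..n} = insert 0 {1..n}" by auto
  then have split: "(\<Prod>k\<le>n. f k) = f 0 * (\<Prod>k\<in>{1..n}. f k)" for f :: "nat \<Rightarrow> K"
    by simp
  have "ct (ser_mult (ser_monom (pref_exp Q1)) (dyson n a)) =
    qq ^ \<pi> 0 / qq ^ \<pi> 1 * M * (factor 0 * (\<Prod>k\<in>{1..n}. factor k))"
    unfolding ct_factors[OF False] split
    by (subst mono_eval_pref) (simp_all add: qq_nonzero M_def)
  also have "\<dots> = (qq ^ \<pi> 0 / qq ^ \<pi> 1 * qbracket (P 1) (\<pi> 0)) * (-1) ^ card Q1 / (1 - qq ^ c) *
      (qpochK total / qpochK (a 0)) * (G / D)"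
    unfolding pf f0 using M0 pos by (simp add: mult_ac)
  also have "\<dots> = (-1) ^ card Q1 * ((qq ^ a (\<sigma> 1) - qq ^ a (\<sigma> 2)) / (1 - qq ^ c)) *
      (qpochK total / (\<Prod>i\<le>n. qpochK (a i))) *
      (\<Prod>i\<in>{1..n}. (1 - qq ^ a i) / (1 - qq ^ tail i))"
    unfolding head split G_def D_def prod_dividef by (simp add: mult_ac)
  finally show ?thesis unfolding c_def tail_def .
qed

end

theorem theorem1:
  fixes n :: nat and a :: "nat \<Rightarrow> nat" and Q1 :: "(nat \<times> nat) set"
  assumes "2 \<le> n"
    and "Q1 \<subseteq> {(i, j). 2 \<le> i \<and> i < j \<and> j \<le> n}"
  shows "(\<not> tour_transitive n Q1 \<longrightarrow>
            ct (ser_mult (ser_monom (pref_exp Q1)) (dyson n a)) = 0)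
       \<and> (\<forall>\<sigma>. tour_transitive n Q1 \<and> winner_perm n Q1 \<sigma> \<longrightarrow>
            ct (ser_mult (ser_monom (pref_exp Q1)) (dyson n a)) =
              (-1) ^ card Q1
              * ((qq ^ a (\<sigma> 1) - qq ^ a (\<sigma> 2)) / (1 - qq ^ (a 0 + a (\<sigma> 2))))
              * (qpochK (\<Sum>i\<le>n. a i) / (\<Prod>i\<le>n. qpochK (a i)))
              * (\<Prod>i=1..n. (1 - qq ^ a i) / (1 - qq ^ (a 0 + (\<Sum>k=1..i. a (\<sigma> k))))))"
proof (cases "\<forall>j. 1 \<le> j \<longrightarrow> j \<le> n \<longrightarrow> 1 \<le> a j")
  case True
  then interpret dyson_tournament n a Q1
    using assms by unfold_locales auto
  show ?thesis
  proof (intro conjI impI allI)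
    assume "\<not> tour_transitive n Q1"
    then show "ct (ser_mult (ser_monom (pref_exp Q1)) (dyson n a)) = 0"
      by (rule ct_nontransitive)
  next
    fix \<sigma> assume "tour_transitive n Q1 \<and> winner_perm n Q1 \<sigma>"
    then interpret transitive_dyson_tournament n a Q1 \<sigma>
      by unfold_locales auto
    show "ct (ser_mult (ser_monom (pref_exp Q1)) (dyson n a)) =
              (-1) ^ card Q1
              * ((qq ^ a (\<sigma> 1) - qq ^ a (\<sigma> 2)) / (1 - qq ^ (a 0 + a (\<sigma> 2))))
              * (qpochK (\<Sum>i\<le>n. a i) / (\<Prod>i\<le>n. qpochK (a i)))
              * (\<Prod>i=1..n. (1 - qq ^ a i) / (1 - qq ^ (a 0 + (\<Sum>k=1..i. a (\<sigma> k)))))"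
      by (rule ct_transitive)
  qed
next
  case False
  then obtain l where l: "1 \<le> l" "l \<le> n" "a l = 0" by (auto simp: not_le)
  have "ct (ser_mult (ser_monom (pref_exp Q1)) (dyson n a)) = 0"
    by (rule ct_zero_parameter[of n Q1 l a, OF assms l])
  \<comment> \<open>The factor at \<open>l\<close> has numerator 1 - q^0. Denominators may also
    vanish in this case, but a quotient by 0 is 0.\<close>
  moreover have "(\<Prod>i=1..n. (1 - qq ^ a i) / (1 - qq ^ (a 0 + (\<Sum>k=1..i. a (\<sigma> k))))) = 0" for \<sigma>
    using l by (intro prod_zero) (auto intro!: bexI[of _ l])
  ultimately show ?thesis by simp
qed

end
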